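(* Fix $\alpha>0$. There are constants $C>0$, $K>0$ depending only on $\alpha$ such that for all $x\geq 2$ and $N\geq 1$, $$ \mathbb{P}\Big(\frac{1}{N} \Big|\frac{\Lambda'}{\Lambda}\Big(\frac{\alpha}{N}\Big)\Big| \geq x \Big) \leq K e^{-C x\log x}, $$ where the probability is over Haar-distributed $g\in U(N)$.
   Context: For $g\in U(N)$ and $A\in\mathbb{C}$, $\Lambda(A):=\det(1-e^{-A}g)$ is the (modified) characteristic polynomial, and $\Lambda'$ denotes its derivative with respect to $A$. $U(N)$ carries Haar probability measure. *)

theory Defs
  imports
    "HOL-Analysis.Analysis"
    "HOL-Probability.Probability_Measure"
    "Jordan_Normal_Form.Schur_Decomposition"
begin

hide_const (open) Determinants.det

definition unitary_group :: "nat \<Rightarrow> complex mat set" where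
  "unitary_group N =
    {g \<in> carrier_mat N N. mat_adjoint g * g = 1\<^sub>m N \<and> g * mat_adjoint g = 1\<^sub>m N}"

text \<open>
  The type of matrices carries no topology. The usual one on the unitary group is
  inherited from the space of matrix entries.
\<close>

definition unitary_topology :: "nat \<Rightarrow> complex mat topology" where
  "unitary_topology N =
    pullback_topology (unitary_group N)
      (\<lambda>g. \<lambda>ij\<in>{..<N} \<times> {..<N}. g $$ ij)
      (product_topology (\<lambda>_. euclidean) ({..<N} \<times> {..<N}))"

lemma topspace_unitary_topology: "topspace (unitary_topology N) = unitary_group N"
  unfolding unitary_topology_def topspace_pullback_topology by auto

definition unitary_borel :: "nat \<Rightarrow> complex mat measure" where
  "unitary_borel N = sigma (unitary_group N) {U. openin (unitary_topology N) U}"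

text \<open>
  On a compact second countable group the left-invariant Borel probability measure is unique,
  and it is automatically regular and right-invariant.
\<close>

definition haar_prob_unitary :: "nat \<Rightarrow> complex mat measure \<Rightarrow> bool" where
  "haar_prob_unitary N \<mu> \<longleftrightarrow>
    prob_space \<mu> \<and>
    space \<mu> = unitary_group N \<and>
    sets \<mu> = sets (unitary_borel N) \<and>
    (\<forall>h\<in>unitary_group N. \<forall>B\<in>sets \<mu>. emeasure \<mu> ((\<lambda>g. h * g) ` B) = emeasure \<mu> B)"

definition Lambda :: "complex mat \<Rightarrow> complex \<Rightarrow> complex" where
  "Lambda g A = det (1\<^sub>m (dim_row g) - exp (- A) \<cdot>\<^sub>m g)"

end

theory Submission
  imports Defs
begin

text \<open>
  Write \<open>p\<^sub>k = Tr g\<^sup>k\<close>. Invariance under infinitesimal left multiplications yields loop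
  equations for the mixed moments of the \<open>p\<^sub>k\<close> and their conjugates. The moments of independent
  complex Gaussians with variances \<open>k\<close> satisfy the same equations, and for holomorphic degree at
  most \<open>N\<close> these are diagonally dominant, hence have only one solution (Diaconis--Shahshahani).
  So \<open>E |X|\<^sup>2\<^sup>m = m! (\<Sum>k |a\<^sub>k|\<^sup>2)\<^sup>m\<close> for \<open>X = \<Sum>a\<^sub>k p\<^sub>k\<close> with \<open>k \<le> L\<close>, as long as \<open>m L \<le> N\<close>.

  The logarithmic derivative is a sum over the eigenvalues of a function concentrated at scale
  \<open>1/N\<close> around 1. Its Fejer mean of order \<open>K\<close> is such an \<open>X\<close>, and the error is dominated by a
  nonnegative trigonometric polynomial of degree less than \<open>K\<close>, whose sum over the eigenvalues is
  \<open>O(N/K)\<close> plus another such \<open>X\<close>. Taking \<open>K\<close> of order \<open>N/x\<close> makes the deterministic part smaller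
  than \<open>x\<close> and leaves room for moments of order \<open>m\<close> comparable to \<open>x\<close>, for which Markov's
  inequality gives \<open>m! (C/x\<^sup>2)\<^sup>m = exp (- c x ln x)\<close> up to constants.
\<close>

text \<open>Gaussian moments are available only up to a degree, so everything random has to be a
  trigonometric polynomial in the eigenvalues. The Fejer remainder is none, and it is not small
  pointwise: at an eigenvalue near 1 it can be of order N. Its absolute values are summed, so a
  nonnegative polynomial of comparable size serves as well, and that polynomial is open to the same
  moments.

  Uniqueness for the loop equations is a count: in weight n the leading coefficient is N, the
  remaining coefficients on unknowns of weight n add up to n - 1, and the other side has lower
  holomorphic weight. The weight of the conjugate side stays free, which later lets conjugate
  factors be contracted one by one.

  In the estimates \<alpha> enters through 1 / (1 - exp (- \<alpha>/N)) \<le> (1 + 1/\<alpha>) N.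
  Both combinations have coefficients O(1/K), so their variances stay bounded whatever K is. For m
  comparable to x the factorial costs about x^m while Markov gains x^(2m); what is left is of the
  order x^(-m).\<close>

section \<open>Loop equations and their Gaussian solution\<close>

text \<open>
  The mixed moment of \<open>\<Prod>Z\<^sub>k\<close> over \<open>\<rho>\<close> against the conjugate product over \<open>\<nu>\<close>, for independent
  centred complex Gaussians \<open>Z\<^sub>k\<close> with \<open>E |Z\<^sub>k|\<^sup>2 = k\<close>.
\<close>
definition wick :: "nat multiset \<Rightarrow> nat multiset \<Rightarrow> complex" where
  "wick \<rho> \<nu> = (if \<rho> = \<nu> then \<Prod>k\<in>set_mset \<rho>. fact (count \<rho> k) * of_nat k ^ count \<rho> k else 0)"

lemma wick_commute: "wick \<rho> \<nu> = wick \<nu> \<rho>"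
  by (auto simp: wick_def)

lemma wick_empty_left: "wick {#} \<nu> = (if \<nu> = {#} then 1 else 0)"
  by (auto simp: wick_def)

text \<open>Gaussian integration by parts: the factor of index j pairs with one of the
  \<open>count \<nu> j\<close> conjugate factors of the same index, each pairing being worth the
  variance j.\<close>

lemma wick_add_mset_left:
  "wick (add_mset j \<rho>) \<nu> = of_nat (j * count \<nu> j) * wick \<rho> (\<nu> - {#j#})"
proof (cases "add_mset j \<rho> = \<nu>")
  case True
  let ?w = "\<lambda>(\<rho>::nat multiset) k. fact (count \<rho> k) * of_nat k ^ count \<rho> k :: complex"
  \<comment> \<open>An index of multiplicity 0 contributes the factor 1, so j may join the index set
    whether or not it occurs in \<rho>.\<close>
  have w: "(\<Prod>k\<in>set_mset \<rho>. ?w \<rho> k) = (\<Prod>k\<in>insert j (set_mset \<rho>). ?w \<rho> k)" for \<rho>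
    by (intro prod.mono_neutral_left) (auto simp: not_in_iff)
  have "(\<Prod>k\<in>set_mset \<nu>. ?w \<nu> k) = ?w \<nu> j * (\<Prod>k\<in>set_mset \<rho> - {j}. ?w \<nu> k)"
    using True[symmetric] by (simp add: prod.insert_remove)
  also have "(\<Prod>k\<in>set_mset \<rho> - {j}. ?w \<nu> k) = (\<Prod>k\<in>set_mset \<rho> - {j}. ?w \<rho> k)"
    using True by (intro prod.cong) auto
  also have "?w \<nu> j = of_nat (j * count \<nu> j) * ?w \<rho> j"
    using True by (auto simp: algebra_simps)
  also have "\<dots> * (\<Prod>k\<in>set_mset \<rho> - {j}. ?w \<rho> k) = of_nat (j * count \<nu> j) * (\<Prod>k\<in>set_mset \<rho>. ?w \<rho> k)"
    unfolding w[of \<rho>] by (simp add: prod.insert_remove)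
  finally show ?thesis using True by (auto simp: wick_def)
next
  case False
  then show ?thesis
    by (auto simp: wick_def not_in_iff[symmetric] dest: insert_DiffM)
qed

text \<open>Trades a multiplicity for a sum over occurrences, the shape of the sums in
  \<open>loop_equation\<close>.\<close>

lemma sum_mset_delta_remove:
  fixes f :: "'a multiset \<Rightarrow> 'b::comm_semiring_1"
  shows "(\<Sum>l\<in>#\<nu>. if l = j then f (\<nu> - {#l#}) else 0) = of_nat (count \<nu> j) * f (\<nu> - {#j#})"
proof -
  have "(\<Sum>l\<in>#\<nu>. if l = j then f (\<nu> - {#l#}) else 0) = (\<Sum>l\<in>#\<nu>. if l = j then f (\<nu> - {#j#}) else 0)"
    by (intro arg_cong[where f = sum_mset] image_mset_cong) auto
  also have "\<dots> = of_nat (count \<nu> j) * f (\<nu> - {#j#})"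
    by (induction \<nu> arbitrary: f) (auto simp: sum_mset_delta algebra_simps)
  finally show ?thesis .
qed

lemma wick_add_mset_left_sum:
  "wick (add_mset j \<rho>) \<nu> = (\<Sum>l\<in>#\<nu>. if l = j then of_nat j * wick \<rho> (\<nu> - {#l#}) else 0)"
  using sum_mset_delta_remove[of j "\<lambda>\<nu>. of_nat j * wick \<rho> \<nu>" \<nu>]
  by (simp add: wick_add_mset_left algebra_simps)

lemma wick_add_mset_right_sum:
  "wick \<rho> (add_mset j \<nu>) = (\<Sum>l\<in>#\<rho>. if l = j then of_nat j * wick (\<rho> - {#l#}) \<nu> else 0)"
  using wick_add_mset_left_sum[of j \<nu> \<rho>] by (simp add: wick_commute cong: if_cong)

text \<open>The Schwinger-Dyson equation for the trace of the i-th power of g. On the left the power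
  is cut into two traces or merges with some \<open>ptr l\<close> from \<rho>; on the right a
  conjugate \<open>ptr l\<close> from \<nu> cancels part of it. The cut at 0 and the case l = i
  produce the trace of the identity; writing it as N keeps the index 0 out of the multisets.\<close>

definition loop_equation ::
    "nat \<Rightarrow> (nat multiset \<Rightarrow> nat multiset \<Rightarrow> complex) \<Rightarrow> nat \<Rightarrow> nat multiset \<Rightarrow> nat multiset \<Rightarrow> bool" where
  "loop_equation N M i \<rho> \<nu> \<longleftrightarrow>
     of_nat N * M (add_mset i \<rho>) \<nu>
       + (\<Sum>j\<in>{1..<i}. M (add_mset j (add_mset (i - j) \<rho>)) \<nu>)
       + (\<Sum>l\<in>#\<rho>. of_nat l * M (add_mset (i + l) (\<rho> - {#l#})) \<nu>)
     = (\<Sum>l\<in>#\<nu>. of_nat l *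
          (if l = i then of_nat N * M \<rho> (\<nu> - {#l#})
           else if l < i then M (add_mset (i - l) \<rho>) (\<nu> - {#l#})
           else M \<rho> (add_mset (l - i) (\<nu> - {#l#}))))"

lemma sum_sum_mset_swap:
  "(\<Sum>j\<in>A. \<Sum>l\<in>#\<nu>. f j l) = (\<Sum>l\<in>#\<nu>. \<Sum>j\<in>A. (f j l :: 'a::comm_monoid_add))"
  by (induction \<nu>) (auto simp: sum.distrib)

text \<open>Contract the newly created factor of each term on the left with some l in \<nu>:
  \<open>R1\<close> forces l = i, \<open>R2\<close> forces l = j < i, and \<open>R3\<close> forces l
  = i + k. For fixed l these match the three cases on the right.\<close>

lemma loop_equation_wick:
  assumes pos: "0 \<notin># \<nu>"
  shows "loop_equation N wick i \<rho> \<nu>"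
proof -
  define R1 where "R1 l = (if l = i then of_nat N * (of_nat i * wick \<rho> (\<nu> - {#l#})) else 0)" for l
  define R2 where "R2 l = (\<Sum>j\<in>{1..<i}. if l = j then of_nat j * wick (add_mset (i - j) \<rho>) (\<nu> - {#l#}) else 0)" for l
  define R3 where "R3 l = (\<Sum>k\<in>#\<rho>. of_nat k * (if l = i + k then of_nat (i + k) * wick (\<rho> - {#k#}) (\<nu> - {#l#}) else 0))" for l
  have "of_nat N * wick (add_mset i \<rho>) \<nu> = (\<Sum>l\<in>#\<nu>. R1 l)"
    unfolding R1_def wick_add_mset_left_sum sum_mset_distrib_left
    by (intro arg_cong[where f = sum_mset] image_mset_cong) auto
  moreover have "(\<Sum>j\<in>{1..<i}. wick (add_mset j (add_mset (i - j) \<rho>)) \<nu>) = (\<Sum>l\<in>#\<nu>. R2 l)"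
    unfolding R2_def by (subst sum_sum_mset_swap[symmetric], subst wick_add_mset_left_sum) simp
  moreover have "(\<Sum>k\<in>#\<rho>. of_nat k * wick (add_mset (i + k) (\<rho> - {#k#})) \<nu>) = (\<Sum>l\<in>#\<nu>. R3 l)"
    unfolding R3_def wick_add_mset_left_sum[of "i + _"] sum_mset_distrib_left
    by (rule sum_mset.swap)
  ultimately have "of_nat N * wick (add_mset i \<rho>) \<nu>
       + (\<Sum>j\<in>{1..<i}. wick (add_mset j (add_mset (i - j) \<rho>)) \<nu>)
       + (\<Sum>l\<in>#\<rho>. of_nat l * wick (add_mset (i + l) (\<rho> - {#l#})) \<nu>)
      = (\<Sum>l\<in>#\<nu>. R1 l + R2 l + R3 l)" by (simp add: sum_mset.distrib)
  also have "\<dots> = (\<Sum>l\<in>#\<nu>. of_nat l *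
          (if l = i then of_nat N * wick \<rho> (\<nu> - {#l#})
           else if l < i then wick (add_mset (i - l) \<rho>) (\<nu> - {#l#})
           else wick \<rho> (add_mset (l - i) (\<nu> - {#l#}))))"
  proof (intro arg_cong[where f = sum_mset] image_mset_cong)
    fix l assume l: "l \<in># \<nu>"
    have l0: "l > 0" using l pos by (cases l) auto
    have R3: "R3 l = (if i \<le> l then (\<Sum>k\<in>#\<rho>. of_nat l * (if k = l - i then of_nat (l - i) * wick (\<rho> - {#k#}) (\<nu> - {#l#}) else 0)) else 0)"
    proof (cases "i \<le> l")
      case True
      then have "R3 l = (\<Sum>k\<in>#\<rho>. of_nat l * (if k = l - i then of_nat (l - i) * wick (\<rho> - {#k#}) (\<nu> - {#l#}) else 0))"
        unfolding R3_def by (intro arg_cong[where f = sum_mset] image_mset_cong) auto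
      then show ?thesis using True by simp
    next
      case False
      then show ?thesis unfolding R3_def by (auto intro!: sum_mset.neutral)
    qed
    have R3': "R3 l = (if i \<le> l then of_nat l * wick \<rho> (add_mset (l - i) (\<nu> - {#l#})) else 0)"
      unfolding R3 wick_add_mset_right_sum[of \<rho> "l - i"] sum_mset_distrib_left by simp
    \<comment> \<open>At l = i the formula inserts the index 0, whose variance 0 makes
      \<open>wick\<close> vanish, so that \<open>R1\<close> alone survives.\<close>
    have R3'': "R3 l = 0" if "l = i"
      unfolding R3' using that wick_commute[of \<rho>] by (simp add: wick_add_mset_left)
    have R2: "R2 l = (if l < i then of_nat l * wick (add_mset (i - l) \<rho>) (\<nu> - {#l#}) else 0)"
      unfolding R2_def using l0 by (subst sum.delta') auto
    show "R1 l + R2 l + R3 l = of_nat l *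
          (if l = i then of_nat N * wick \<rho> (\<nu> - {#l#})
           else if l < i then wick (add_mset (i - l) \<rho>) (\<nu> - {#l#})
           else wick \<rho> (add_mset (l - i) (\<nu> - {#l#})))"
    proof (cases "l = i")
      case True
      then show ?thesis using R3'' R2 by (simp add: R1_def)
    next
      case False
      then show ?thesis by (simp add: R1_def R2 R3')
    qed
  qed
  finally show ?thesis unfolding loop_equation_def .
qed

lemma norm_sum_mset_le: "norm (\<Sum>x\<in>#A. f x :: complex) \<le> (\<Sum>x\<in>#A. norm (f x))"
  by (induction A) (auto intro: order_trans[OF norm_triangle_ineq])

text \<open>Take a part i of \<rho>. The other unknowns of the same weight n carry total coefficient
  (i - 1) + (n - i) = n - 1 < N, and the right side vanishes by induction. So the supremum c of the
  errors satisfies N c \<le> (n - 1) c. The induction leaves \<nu> arbitrary because the right side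
  changes it.\<close>

lemma loop_equation_unique:
  assumes loop: "\<And>i \<rho> \<nu>. i > 0 \<Longrightarrow> 0 \<notin># \<rho> \<Longrightarrow> 0 \<notin># \<nu> \<Longrightarrow> loop_equation N M i \<rho> \<nu>"
    and bdd: "\<And>n \<nu>. \<exists>B. \<forall>\<rho>. 0 \<notin># \<rho> \<longrightarrow> sum_mset \<rho> = n \<longrightarrow> norm (M \<rho> \<nu>) \<le> B"
    and base: "\<And>\<nu>. 0 \<notin># \<nu> \<Longrightarrow> M {#} \<nu> = wick {#} \<nu>"
    and "0 \<notin># \<rho>" "0 \<notin># \<nu>" "sum_mset \<rho> \<le> N"
  shows "M \<rho> \<nu> = wick \<rho> \<nu>"
  using assms(4-6)
proof (induction "sum_mset \<rho>" arbitrary: \<rho> \<nu> rule: less_induct)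
  case less
  define n where "n = sum_mset \<rho>"
  define D where "D \<rho> \<nu> = M \<rho> \<nu> - wick \<rho> \<nu>" for \<rho> \<nu>
  define S where "S = {\<rho>. 0 \<notin># \<rho> \<and> sum_mset \<rho> = n}"
  show ?case
  proof (cases "n = 0")
    case True
    then have "\<rho> = {#}" using less.prems(1) unfolding n_def
      by (cases \<rho>) auto
    then show ?thesis using base less.prems by simp
  next
    case False
    have IH: "D \<rho>' \<nu>' = 0" if "sum_mset \<rho>' < n" "0 \<notin># \<rho>'" "0 \<notin># \<nu>'" for \<rho>' \<nu>'
      using less.hyps[of \<rho>' \<nu>'] that less.prems unfolding D_def n_def by auto
    obtain B where B: "\<And>\<rho>. \<rho> \<in> S \<Longrightarrow> norm (M \<rho> \<nu>) \<le> B" using bdd[of n \<nu>] unfolding S_def by auto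
    \<comment> \<open>\<open>wick\<close> is nonzero on the diagonal only, so its value at \<nu>
      bounds it over all \<rho>.\<close>
    have bdd': "bdd_above ((\<lambda>\<rho>. norm (D \<rho> \<nu>)) ` S)"
    proof (rule bdd_aboveI2)
      fix \<rho> assume "\<rho> \<in> S"
      have "norm (wick \<rho> \<nu>) \<le> norm (wick \<nu> \<nu>)" by (auto simp: wick_def)
      then show "norm (D \<rho> \<nu>) \<le> B + norm (wick \<nu> \<nu>)"
        unfolding D_def using B[OF \<open>\<rho> \<in> S\<close>] norm_triangle_ineq4[of "M \<rho> \<nu>" "wick \<rho> \<nu>"] by linarith
    qed
    define c where "c = (SUP \<rho>\<in>S. norm (D \<rho> \<nu>))"
    have le_c: "norm (D \<rho> \<nu>) \<le> c" if "\<rho> \<in> S" for \<rho>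
      unfolding c_def by (rule cSUP_upper[OF that bdd'])
    have ne: "\<rho> \<in> S" using less.prems unfolding S_def n_def by auto
    have main: "real N * norm (D \<rho> \<nu>) \<le> real (n - 1) * c" if "\<rho> \<in> S" for \<rho>
    proof -
      have lam: "0 \<notin># \<rho>" "sum_mset \<rho> = n" using that unfolding S_def by auto
      then have "\<rho> \<noteq> {#}" using False by auto
      then obtain i \<kappa> where \<rho>: "\<rho> = add_mset i \<kappa>" by (meson multiset_cases)
      have i: "i > 0" and \<kappa>: "0 \<notin># \<kappa>" using lam(1) \<rho> by auto
      have n: "n = i + sum_mset \<kappa>" using lam \<rho> by simp
      have le: "l \<le> sum_mset \<kappa>" if "l \<in># \<kappa>" for l using that
        by (auto dest!: multi_member_split)
      have pos: "l > 0" if "l \<in># \<kappa>" for l using that \<kappa> by (cases l) auto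
      have pos\<nu>: "l > 0" if "l \<in># \<nu>" for l using that less.prems by (cases l) auto
      have removeS: "sum_mset (\<kappa> - {#l#}) = sum_mset \<kappa> - l" if "l \<in># \<kappa>" for l
        using that by (simp add: sum_mset_diff)
      \<comment> \<open>All these terms have weight below n: i is taken away and at most i - l, with
        l > 0, is put back.\<close>
      have zero: "(if l = i then of_nat N * D \<kappa> (\<nu> - {#l#})
           else if l < i then D (add_mset (i - l) \<kappa>) (\<nu> - {#l#})
           else D \<kappa> (add_mset (l - i) (\<nu> - {#l#}))) = 0" if "l \<in># \<nu>" for l
        using i n \<kappa> less.prems pos\<nu>[OF that] by (auto intro!: IH dest: in_diffD)
      have "loop_equation N M i \<kappa> \<nu>" "loop_equation N wick i \<kappa> \<nu>"
        using loop[OF i \<kappa>] loop_equation_wick less.prems by auto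
      then have "of_nat N * D \<rho> \<nu>
         + (\<Sum>j\<in>{1..<i}. D (add_mset j (add_mset (i - j) \<kappa>)) \<nu>)
         + (\<Sum>l\<in>#\<kappa>. of_nat l * D (add_mset (i + l) (\<kappa> - {#l#})) \<nu>)
        = (\<Sum>l\<in>#\<nu>. of_nat l * (if l = i then of_nat N * D \<kappa> (\<nu> - {#l#})
           else if l < i then D (add_mset (i - l) \<kappa>) (\<nu> - {#l#})
           else D \<kappa> (add_mset (l - i) (\<nu> - {#l#}))))"
      proof -
        have *: "(\<Sum>x\<in>#A. f x) - (\<Sum>x\<in>#A. g x) = (\<Sum>x\<in>#A. f x - g x :: complex)" for A :: "nat multiset" and f g
          by (induction A) auto
        assume a: "loop_equation N M i \<kappa> \<nu>" and b: "loop_equation N wick i \<kappa> \<nu>"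
        have hD: "(\<Sum>l\<in>#\<nu>. of_nat l * (if l = i then of_nat N * D \<kappa> (\<nu> - {#l#})
           else if l < i then D (add_mset (i - l) \<kappa>) (\<nu> - {#l#})
           else D \<kappa> (add_mset (l - i) (\<nu> - {#l#})))) = 
           (\<Sum>l\<in>#\<nu>. of_nat l * (if l = i then of_nat N * M \<kappa> (\<nu> - {#l#})
           else if l < i then M (add_mset (i - l) \<kappa>) (\<nu> - {#l#})
           else M \<kappa> (add_mset (l - i) (\<nu> - {#l#})))) - 
           (\<Sum>l\<in>#\<nu>. of_nat l * (if l = i then of_nat N * wick \<kappa> (\<nu> - {#l#})
           else if l < i then wick (add_mset (i - l) \<kappa>) (\<nu> - {#l#})
           else wick \<kappa> (add_mset (l - i) (\<nu> - {#l#}))))"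
          unfolding * D_def by (intro arg_cong[where f = sum_mset] image_mset_cong) (auto simp: algebra_simps)
        have hA: "of_nat N * D \<rho> \<nu> = of_nat N * M (add_mset i \<kappa>) \<nu> - of_nat N * wick (add_mset i \<kappa>) \<nu>"
          unfolding \<rho> D_def by (simp add: algebra_simps)
        have hB: "(\<Sum>j\<in>{1..<i}. D (add_mset j (add_mset (i - j) \<kappa>)) \<nu>) =
            (\<Sum>j\<in>{1..<i}. M (add_mset j (add_mset (i - j) \<kappa>)) \<nu>) -
            (\<Sum>j\<in>{1..<i}. wick (add_mset j (add_mset (i - j) \<kappa>)) \<nu>)"
          unfolding D_def by (simp add: sum_subtractf)
        have hC: "(\<Sum>l\<in>#\<kappa>. of_nat l * D (add_mset (i + l) (\<kappa> - {#l#})) \<nu>) =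
            (\<Sum>l\<in>#\<kappa>. of_nat l * M (add_mset (i + l) (\<kappa> - {#l#})) \<nu>) -
            (\<Sum>l\<in>#\<kappa>. of_nat l * wick (add_mset (i + l) (\<kappa> - {#l#})) \<nu>)"
          unfolding * D_def by (simp add: algebra_simps)
        have comb: "(a1 - a2) + (b1 - b2) + (c1 - c2) = r1 - r2"
          if "a1 + b1 + c1 = r1" "a2 + b2 + c2 = r2" for a1 a2 b1 b2 c1 c2 r1 r2 :: complex
          using that by auto
        show ?thesis
          unfolding hA hB hC hD by (rule comb[OF a[unfolded loop_equation_def] b[unfolded loop_equation_def]])
      qed
      also have "\<dots> = 0"
        using zero by (intro sum_mset.neutral) auto
      finally have "of_nat N * D \<rho> \<nu> = - ((\<Sum>j\<in>{1..<i}. D (add_mset j (add_mset (i - j) \<kappa>)) \<nu>)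
         + (\<Sum>l\<in>#\<kappa>. of_nat l * D (add_mset (i + l) (\<kappa> - {#l#})) \<nu>))"
        by (simp only: eq_neg_iff_add_eq_0 add.assoc)
      then have "norm (of_nat N * D \<rho> \<nu>) = norm ((\<Sum>j\<in>{1..<i}. D (add_mset j (add_mset (i - j) \<kappa>)) \<nu>)
         + (\<Sum>l\<in>#\<kappa>. of_nat l * D (add_mset (i + l) (\<kappa> - {#l#})) \<nu>))"
        by (simp only: norm_minus_cancel)
      then have "real N * norm (D \<rho> \<nu>) = norm ((\<Sum>j\<in>{1..<i}. D (add_mset j (add_mset (i - j) \<kappa>)) \<nu>)
         + (\<Sum>l\<in>#\<kappa>. of_nat l * D (add_mset (i + l) (\<kappa> - {#l#})) \<nu>))"
        by (simp only: norm_mult norm_of_nat)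
      also have "\<dots> \<le> (\<Sum>j\<in>{1..<i}. norm (D (add_mset j (add_mset (i - j) \<kappa>)) \<nu>))
         + (\<Sum>l\<in>#\<kappa>. norm (of_nat l * D (add_mset (i + l) (\<kappa> - {#l#})) \<nu>))"
        by (intro order_trans[OF norm_triangle_ineq] add_mono norm_sum norm_sum_mset_le)
      also have "\<dots> \<le> (\<Sum>j\<in>{1..<i}. c) + (\<Sum>l\<in>#\<kappa>. real l * c)"
      proof (intro add_mono sum_mono sum_mset_mono)
        fix j assume "j \<in> {1..<i}"
        then show "norm (D (add_mset j (add_mset (i - j) \<kappa>)) \<nu>) \<le> c"
          using n \<kappa> by (intro le_c) (auto simp: S_def)
      next
        fix l assume l: "l \<in># \<kappa>"
        show "norm (of_nat l * D (add_mset (i + l) (\<kappa> - {#l#})) \<nu>) \<le> real l * c"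
          unfolding norm_mult norm_of_nat using n \<kappa> le[OF l] removeS[OF l] pos[OF l]
          by (intro mult_left_mono le_c) (auto simp: S_def dest: in_diffD)
      qed
      also have "(\<Sum>l\<in>#\<kappa>. real l * c) = real (sum_mset \<kappa>) * c"
        by (induction \<kappa>) (auto simp: algebra_simps)
      also have "(\<Sum>j\<in>{1..<i}. c) + real (sum_mset \<kappa>) * c = real (n - 1) * c"
        using n i by (simp add: algebra_simps of_nat_diff)
      finally show ?thesis .
    qed
    have "n \<le> N" using less.prems unfolding n_def by simp
    with False have nN: "n \<le> N" "N > 0" by auto
    have "(SUP \<rho>\<in>S. norm (D \<rho> \<nu>)) \<le> real (n - 1) * c / real N"
      using main nN ne by (intro cSUP_least) (auto simp: pos_le_divide_eq mult.commute)
    then have "c \<le> real (n - 1) * c / real N" unfolding c_def .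
    then have "real N * c \<le> real (n - 1) * c" using nN by (simp add: field_simps)
    then have "(real N - real (n - 1)) * c \<le> 0" by (simp add: algebra_simps)
    moreover have "real N - real (n - 1) > 0" using nN False by simp
    ultimately have "c \<le> 0" by (simp add: mult_le_0_iff)
    then have "norm (D \<rho> \<nu>) \<le> 0" using le_c[OF ne] by linarith
    then show ?thesis by (simp add: D_def)
  qed
qed

section \<open>Haar measure on the unitary group\<close>

lemma mult_mat_entry:
  assumes "A \<in> carrier_mat n m" "B \<in> carrier_mat m p" "i < n" "j < p"
  shows "(A * B) $$ (i, j) = (\<Sum>k<m. A $$ (i, k) * B $$ (k, j))"
  using assms by (auto simp: scalar_prod_def atLeast0LessThan intro!: sum.cong)

lemma dim_mat_adjoint [simp]:
  "dim_row (mat_adjoint A) = dim_col A" "dim_col (mat_adjoint A) = dim_row A"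
  by (auto simp: mat_adjoint_def)

lemma mat_adjoint_carrier [simp]: "A \<in> carrier_mat n m \<Longrightarrow> mat_adjoint A \<in> carrier_mat m n"
  by (auto simp: mat_adjoint_def)

lemma mat_adjoint_entry:
  fixes A :: "complex mat"
  assumes "A \<in> carrier_mat n m" "i < m" "j < n"
  shows "mat_adjoint A $$ (i, j) = cnj (A $$ (j, i))"
  using assms by (auto simp: mat_adjoint_def mat_of_rows_def)

lemma mat_adjoint_mult:
  fixes A B :: "complex mat"
  assumes A: "A \<in> carrier_mat n m" and B: "B \<in> carrier_mat m p"
  shows "mat_adjoint (A * B) = mat_adjoint B * mat_adjoint A"
proof (rule eq_matI)
  have AB: "A * B \<in> carrier_mat n p" using assms by simp
  fix i j assume "i < dim_row (mat_adjoint B * mat_adjoint A)" "j < dim_col (mat_adjoint B * mat_adjoint A)"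
  then have ij: "i < p" "j < n"
    using mat_adjoint_carrier[OF A] mat_adjoint_carrier[OF B] by auto
  have "mat_adjoint (A * B) $$ (i, j) = (\<Sum>k<m. cnj (A $$ (j, k)) * cnj (B $$ (k, i)))"
    using ij by (simp add: mat_adjoint_entry[OF AB] mult_mat_entry[OF A B])
  also have "\<dots> = (mat_adjoint B * mat_adjoint A) $$ (i, j)"
    using ij by (simp add: mult_mat_entry[OF mat_adjoint_carrier[OF B] mat_adjoint_carrier[OF A]]
        mat_adjoint_entry[OF A] mat_adjoint_entry[OF B] mult.commute)
  finally show "mat_adjoint (A * B) $$ (i, j) = (mat_adjoint B * mat_adjoint A) $$ (i, j)" .
qed (use mat_adjoint_carrier[of "A * B" n p] mat_adjoint_carrier[OF A] mat_adjoint_carrier[OF B] assms in auto)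

lemma mat_adjoint_adjoint:
  fixes A :: "complex mat"
  assumes A: "A \<in> carrier_mat n m"
  shows "mat_adjoint (mat_adjoint A) = A"
  using mat_adjoint_carrier[OF A] mat_adjoint_carrier[OF mat_adjoint_carrier[OF A]] A
  by (intro eq_matI) (auto simp: mat_adjoint_entry[OF A] mat_adjoint_entry[OF mat_adjoint_carrier[OF A]])

lemma unitary_group_carrier: "g \<in> unitary_group N \<Longrightarrow> g \<in> carrier_mat N N"
  by (simp add: unitary_group_def)

lemma one_in_unitary_group [simp]: "1\<^sub>m N \<in> unitary_group N"
proof -
  have "mat_adjoint (1\<^sub>m N :: complex mat) = 1\<^sub>m N"
    using mat_adjoint_carrier[of "1\<^sub>m N :: complex mat" N N]
    by (intro eq_matI) (auto simp: mat_adjoint_entry[of _ N N])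
  then show ?thesis by (simp add: unitary_group_def)
qed

lemma mult_in_unitary_group:
  assumes "g \<in> unitary_group N" "h \<in> unitary_group N"
  shows "g * h \<in> unitary_group N"
proof -
  have c: "g \<in> carrier_mat N N" "h \<in> carrier_mat N N" "mat_adjoint g \<in> carrier_mat N N" "mat_adjoint h \<in> carrier_mat N N"
    using assms by (auto simp: unitary_group_def)
  have four: "(a * b) * (x * d) = 1\<^sub>m N" if "b * x = 1\<^sub>m N" "a * d = 1\<^sub>m N"
    "a \<in> carrier_mat N N" "b \<in> carrier_mat N N" "x \<in> carrier_mat N N" "d \<in> carrier_mat N N"
    for a b x d :: "complex mat"
  proof -
    have "(a * b) * (x * d) = a * ((b * x) * d)"
      using that(3-6) by (simp add: assoc_mult_mat[of _ N N _ N _ N])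
    then show ?thesis using that by simp
  qed
  show ?thesis
    using assms c by (auto simp: unitary_group_def mat_adjoint_mult[OF c(1,2)] intro!: four)
qed

lemma adjoint_in_unitary_group:
  assumes "g \<in> unitary_group N"
  shows "mat_adjoint g \<in> unitary_group N"
  using assms by (auto simp: unitary_group_def mat_adjoint_adjoint)

lemma pow_in_unitary_group: "g \<in> unitary_group N \<Longrightarrow> g ^\<^sub>m k \<in> unitary_group N"
proof (induction k)
  case 0
  then show ?case using unitary_group_carrier[of g N] by auto
qed (auto intro: mult_in_unitary_group)

text \<open>The rows of a unitary matrix are unit vectors. All boundedness of functions on the group
  goes back to this.\<close>

lemma unitary_entry_le_1:
  assumes g: "g \<in> unitary_group N" and ij: "i < N" "j < N"
  shows "cmod (g $$ (i, j)) \<le> 1"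
proof -
  have c: "g \<in> carrier_mat N N" using g by (rule unitary_group_carrier)
  have "1 = (g * mat_adjoint g) $$ (i, i)" using g ij by (simp add: unitary_group_def)
  also have "\<dots> = (\<Sum>k<N. g $$ (i, k) * cnj (g $$ (i, k)))"
    using ij by (simp add: mult_mat_entry[OF c mat_adjoint_carrier[OF c]] mat_adjoint_entry[OF c])
  also have "\<dots> = of_real (\<Sum>k<N. (cmod (g $$ (i, k)))\<^sup>2)"
    by (simp add: complex_norm_square[symmetric] del: of_real_power)
  finally have "(\<Sum>k<N. (cmod (g $$ (i, k)))\<^sup>2) = 1"
    by (metis of_real_eq_1_iff)
  moreover have "(cmod (g $$ (i, j)))\<^sup>2 \<le> (\<Sum>k<N. (cmod (g $$ (i, k)))\<^sup>2)"
    using ij by (intro member_le_sum) auto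
  ultimately show ?thesis by (simp add: abs_square_le_1)
qed

lemma mult_adjoint_cancel:
  assumes h: "h \<in> unitary_group N" and g: "g \<in> carrier_mat N N"
  shows "mat_adjoint h * (h * g) = g" "h * (mat_adjoint h * g) = g"
proof -
  have c: "h \<in> carrier_mat N N" "mat_adjoint h \<in> carrier_mat N N"
    using h by (auto simp: unitary_group_def)
  show "mat_adjoint h * (h * g) = g" "h * (mat_adjoint h * g) = g"
    using h c g by (auto simp: unitary_group_def assoc_mult_mat[symmetric, of _ N N _ N _ N])
qed

section \<open>Borel sets of the group and continuity of left translations\<close>

lemma space_unitary_borel [simp]: "space (unitary_borel N) = unitary_group N"
  unfolding unitary_borel_def
  by (rule space_measure_of) (use openin_subset[of "unitary_topology N"] in \<open>auto simp: topspace_unitary_topology\<close>)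

lemma openin_in_sets_unitary_borel:
  assumes "openin (unitary_topology N) U"
  shows "U \<in> sets (unitary_borel N)"
proof -
  have "{U. openin (unitary_topology N) U} \<subseteq> Pow (unitary_group N)"
    using openin_subset[of "unitary_topology N"] by (auto simp: topspace_unitary_topology)
  then show ?thesis unfolding unitary_borel_def using assms
    by (auto simp: sets_measure_of)
qed

lemma continuous_map_unitary_entry:
  assumes "i < N" "j < N"
  shows "continuous_map (unitary_topology N) euclidean (\<lambda>g. g $$ (i, j))"
proof -
  have "continuous_map (unitary_topology N) euclidean
      ((\<lambda>x. x (i, j)) \<circ> (\<lambda>g. \<lambda>ij\<in>{..<N} \<times> {..<N}. g $$ ij))"
    unfolding unitary_topology_def using assms
    by (intro continuous_map_pullback continuous_map_product_projection) auto
  then show ?thesis using assms by (simp add: o_def)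
qed

lemma measurable_unitary_entry:
  assumes "i < N" "j < N"
  shows "(\<lambda>g. g $$ (i, j)) \<in> borel_measurable (unitary_borel N)"
proof (rule borel_measurableI)
  fix S :: "complex set" assume "open S"
  then have "openin (unitary_topology N) {g \<in> topspace (unitary_topology N). g $$ (i, j) \<in> S}"
    using continuous_map_unitary_entry[OF assms] by (auto intro: openin_continuous_map_preimage)
  moreover have "{g \<in> topspace (unitary_topology N). g $$ (i, j) \<in> S} = (\<lambda>g. g $$ (i, j)) -` S \<inter> space (unitary_borel N)"
    by (auto simp: topspace_unitary_topology)
  ultimately show "(\<lambda>g. g $$ (i, j)) -` S \<inter> space (unitary_borel N) \<in> sets (unitary_borel N)"
    using openin_in_sets_unitary_borel by metis
qed

lemma continuous_map_unitary_mult: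
  assumes h: "h \<in> unitary_group N"
  shows "continuous_map (unitary_topology N) (unitary_topology N) (\<lambda>g. h * g)"
proof -
  have "continuous_map (unitary_topology N) (product_topology (\<lambda>_. euclidean) ({..<N} \<times> {..<N}))
          ((\<lambda>g. \<lambda>ij\<in>{..<N} \<times> {..<N}. g $$ ij) \<circ> (\<lambda>g. h * g))"
    unfolding continuous_map_componentwise
  proof (intro conjI ballI)
    fix ij assume "ij \<in> {..<N} \<times> {..<N}"
    then obtain i j where ij: "ij = (i, j)" "i < N" "j < N" by auto
    have "continuous_map (unitary_topology N) euclidean (\<lambda>g. \<Sum>k<N. h $$ (i, k) * g $$ (k, j))"
    proof (intro continuous_map_sum)
      fix k assume "k \<in> {..<N}"
      then have "continuous_map (unitary_topology N) euclidean ((\<lambda>z. h $$ (i, k) * z) \<circ> (\<lambda>g. g $$ (k, j)))"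
        using ij by (intro continuous_map_compose[OF continuous_map_unitary_entry])
          (auto intro!: continuous_intros)
      then show "continuous_map (unitary_topology N) euclidean (\<lambda>g. h $$ (i, k) * g $$ (k, j))"
        by (simp add: o_def)
    qed auto
    then show "continuous_map (unitary_topology N) euclidean
        (\<lambda>x. ((\<lambda>g. \<lambda>ij\<in>{..<N} \<times> {..<N}. g $$ ij) \<circ> (*) h) x ij)"
      by (rule continuous_map_eq)
        (use ij h in \<open>auto simp: topspace_unitary_topology mult_mat_entry[of _ N N _ N] unitary_group_carrier simp del: index_mult_mat\<close>)
  qed auto
  then show ?thesis
    using h unfolding unitary_topology_def
    by (intro continuous_map_pullback') (auto simp: topspace_pullback_topology intro: mult_in_unitary_group)
qed

lemma measurable_unitary_mult:
  assumes h: "h \<in> unitary_group N"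
  shows "(\<lambda>g. h * g) \<in> measurable (unitary_borel N) (unitary_borel N)"
  unfolding unitary_borel_def[of N]
proof (rule measurable_measure_of)
  show "{U. openin (unitary_topology N) U} \<subseteq> Pow (unitary_group N)"
    using openin_subset[of "unitary_topology N"] by (auto simp: topspace_unitary_topology)
next
  show "(*) h \<in> space (sigma (unitary_group N) {U. openin (unitary_topology N) U}) \<rightarrow> unitary_group N"
    unfolding unitary_borel_def[symmetric] using h by (auto intro: mult_in_unitary_group)
next
  fix y assume "y \<in> {U. openin (unitary_topology N) U}"
  then have "openin (unitary_topology N) {g \<in> topspace (unitary_topology N). h * g \<in> y}"
    using continuous_map_unitary_mult[OF h] by (auto intro: openin_continuous_map_preimage)
  moreover have "{g \<in> topspace (unitary_topology N). h * g \<in> y} = (*) h -` y \<inter> space (unitary_borel N)"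
    by (auto simp: topspace_unitary_topology)
  ultimately show "(*) h -` y \<inter> space (sigma (unitary_group N) {U. openin (unitary_topology N) U})
      \<in> sets (sigma (unitary_group N) {U. openin (unitary_topology N) U})"
    unfolding unitary_borel_def[symmetric] using openin_in_sets_unitary_borel by metis
qed

section \<open>Invariance of integrals, bounded measurable functions and power sums\<close>

locale haar_unitary =
  fixes N :: nat and \<mu> :: "complex mat measure"
  assumes haar: "haar_prob_unitary N \<mu>"
begin

sublocale prob_space \<mu>
  using haar by (simp add: haar_prob_unitary_def)

lemma space_haar [simp]: "space \<mu> = unitary_group N"
  and sets_haar: "sets \<mu> = sets (unitary_borel N)"
  using haar by (auto simp: haar_prob_unitary_def)

lemma prob_unitary_group [simp]: "prob (unitary_group N) = 1"
  using prob_space by simp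

lemma measurable_haar_eq: "measurable \<mu> M = measurable (unitary_borel N) M"
  by (rule measurable_cong_sets) (auto simp: sets_haar)

lemma measurable_mult: "h \<in> unitary_group N \<Longrightarrow> (\<lambda>g. h * g) \<in> measurable \<mu> \<mu>"
  using measurable_unitary_mult[of h N] measurable_cong_sets[OF sets_haar sets_haar] by auto

text \<open>\<open>haar_prob_unitary\<close> speaks of images of sets, a push-forward of preimages.
  They meet because the preimage under multiplication by h is the image under multiplication by
  \<open>mat_adjoint h\<close>.\<close>

lemma distr_mult:
  assumes h: "h \<in> unitary_group N"
  shows "distr \<mu> \<mu> (\<lambda>g. h * g) = \<mu>"
proof (rule measure_eqI)
  fix A assume "A \<in> sets (distr \<mu> \<mu> ((*) h))"
  then have A: "A \<in> sets \<mu>" by simp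
  then have sub: "A \<subseteq> unitary_group N" using sets.sets_into_space by fastforce
  have "(*) h -` A \<inter> space \<mu> = (\<lambda>g. mat_adjoint h * g) ` A"
  proof (intro equalityI subsetI)
    fix g assume "g \<in> (*) h -` A \<inter> space \<mu>"
    then show "g \<in> (*) (mat_adjoint h) ` A"
      using mult_adjoint_cancel(1)[OF h, of g] unitary_group_carrier[of g N] by (auto intro!: image_eqI[of g _ "h * g"])
  next
    fix g assume "g \<in> (*) (mat_adjoint h) ` A"
    then obtain a where a: "a \<in> A" "g = mat_adjoint h * a" by auto
    have "a \<in> unitary_group N" using a sub by auto
    then show "g \<in> (*) h -` A \<inter> space \<mu>"
      using a mult_adjoint_cancel(2)[OF h, of a] unitary_group_carrier[of a N]
        mult_in_unitary_group[OF adjoint_in_unitary_group[OF h]] by auto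
  qed
  then show "emeasure (distr \<mu> \<mu> ((*) h)) A = emeasure \<mu> A"
    using haar adjoint_in_unitary_group[OF h] A measurable_mult[OF h]
    by (simp add: emeasure_distr haar_prob_unitary_def)
qed simp

lemma integral_mult:
  fixes f :: "complex mat \<Rightarrow> complex"
  assumes "h \<in> unitary_group N" "f \<in> borel_measurable \<mu>"
  shows "(\<integral>g. f (h * g) \<partial>\<mu>) = (\<integral>g. f g \<partial>\<mu>)"
  using integral_distr[OF measurable_mult[OF assms(1)] assms(2)] distr_mult[OF assms(1)] by simp

text \<open>An algebra of functions, closed under conjugation, on which integrability is automatic
  because \<mu> is a probability. The bound is asked on the group only: entries of arbitrary
  matrices are unbounded.\<close>

definition bdd_meas :: "(complex mat \<Rightarrow> complex) \<Rightarrow> bool" where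
  "bdd_meas f \<longleftrightarrow> f \<in> borel_measurable \<mu> \<and> (\<exists>B. \<forall>g\<in>unitary_group N. cmod (f g) \<le> B)"

lemma bdd_meas_integrable: "bdd_meas f \<Longrightarrow> integrable \<mu> f"
  unfolding bdd_meas_def using integrable_const_bound[of f] by (metis AE_I2 space_haar)

lemma bdd_meas_const [simp, intro]: "bdd_meas (\<lambda>_. c)"
  by (auto simp: bdd_meas_def)

lemma bdd_meas_mult [intro]:
  assumes "bdd_meas f" "bdd_meas h"
  shows "bdd_meas (\<lambda>g. f g * h g)"
proof -
  obtain A B where "\<forall>g\<in>unitary_group N. cmod (f g) \<le> A" "\<forall>g\<in>unitary_group N. cmod (h g) \<le> B"
    using assms by (auto simp: bdd_meas_def)
  then have "\<forall>g\<in>unitary_group N. cmod (f g * h g) \<le> A * B"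
    by (auto simp: norm_mult intro!: mult_mono) (meson norm_ge_zero order_trans)
  then show ?thesis using assms by (auto simp: bdd_meas_def)
qed

lemma bdd_meas_add [intro]:
  assumes "bdd_meas f" "bdd_meas h"
  shows "bdd_meas (\<lambda>g. f g + h g)"
proof -
  obtain A B where "\<forall>g\<in>unitary_group N. cmod (f g) \<le> A" "\<forall>g\<in>unitary_group N. cmod (h g) \<le> B"
    using assms by (auto simp: bdd_meas_def)
  then have "\<forall>g\<in>unitary_group N. cmod (f g + h g) \<le> A + B"
    by (auto intro!: norm_triangle_le add_mono)
  then show ?thesis using assms by (auto simp: bdd_meas_def)
qed

lemma bdd_meas_uminus [intro]: "bdd_meas f \<Longrightarrow> bdd_meas (\<lambda>g. - f g)"
  by (auto simp: bdd_meas_def)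

lemma bdd_meas_cnj [intro]: "bdd_meas f \<Longrightarrow> bdd_meas (\<lambda>g. cnj (f g))"
  by (auto simp: bdd_meas_def intro: measurable_compose[OF _ borel_measurable_continuous_onI] continuous_intros)

lemma bdd_meas_sum [intro]: "(\<And>x. x \<in> A \<Longrightarrow> bdd_meas (f x)) \<Longrightarrow> bdd_meas (\<lambda>g. \<Sum>x\<in>A. f x g)"
  by (induction A rule: infinite_finite_induct) auto

lemma bdd_meas_sum_mset [intro]: "(\<And>x. x \<in># A \<Longrightarrow> bdd_meas (f x)) \<Longrightarrow> bdd_meas (\<lambda>g. \<Sum>x\<in>#A. f x g)"
  by (induction A) auto

lemma bdd_meas_power [intro]: "bdd_meas f \<Longrightarrow> bdd_meas (\<lambda>g. f g ^ n)"
  by (induction n) auto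

lemma bdd_meas_cong:
  assumes "bdd_meas f" "\<And>g. g \<in> unitary_group N \<Longrightarrow> f g = h g"
  shows "bdd_meas h"
  using assms measurable_cong[of \<mu> f h] by (auto simp: bdd_meas_def)

lemma bdd_meas_entry [intro]:
  assumes "i < N" "j < N"
  shows "bdd_meas (\<lambda>g. g $$ (i, j))"
  using assms measurable_unitary_entry[OF assms] unitary_entry_le_1[of _ N i j]
  by (auto simp: bdd_meas_def measurable_haar_eq)

lemma pow_Suc_entry:
  assumes "g \<in> unitary_group N" "i < N" "j < N"
  shows "(g ^\<^sub>m Suc k) $$ (i, j) = (\<Sum>l<N. (g ^\<^sub>m k) $$ (i, l) * g $$ (l, j))"
  using assms unitary_group_carrier[of g N]
  by (simp add: mult_mat_entry[of _ N N _ N] del: index_mult_mat)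

lemma bdd_meas_pow_entry [intro]:
  assumes "i < N" "j < N"
  shows "bdd_meas (\<lambda>g. (g ^\<^sub>m k) $$ (i, j))"
  using assms
proof (induction k arbitrary: j)
  case 0
  show ?case
    by (rule bdd_meas_cong[of "\<lambda>_. if i = j then 1 else 0"])
      (use 0 in \<open>auto dest!: unitary_group_carrier\<close>)
next
  case (Suc k)
  show ?case
    by (rule bdd_meas_cong[of "\<lambda>g. \<Sum>l<N. (g ^\<^sub>m k) $$ (i, l) * g $$ (l, j)"])
      (use Suc pow_Suc_entry in \<open>auto simp del: pow_mat.simps intro!: bdd_meas_sum bdd_meas_mult bdd_meas_entry\<close>)
qed

text \<open>The k-th power sum of the eigenvalues, written with matrix entries so that it can be
  differentiated without mentioning eigenvalues.\<close>

definition ptr :: "nat \<Rightarrow> complex mat \<Rightarrow> complex" where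
  "ptr k g = (\<Sum>a<N. (g ^\<^sub>m k) $$ (a, a))"

definition ptrs :: "nat multiset \<Rightarrow> complex mat \<Rightarrow> complex" where
  "ptrs \<rho> g = (\<Prod>k\<in>#\<rho>. ptr k g)"

lemma bdd_meas_ptr [intro]: "bdd_meas (ptr k)"
  unfolding ptr_def[abs_def] by auto

lemma ptrs_simps [simp]: "ptrs {#} g = 1" "ptrs (add_mset k \<rho>) g = ptr k g * ptrs \<rho> g"
  by (auto simp: ptrs_def)

lemma bdd_meas_ptrs [intro]: "bdd_meas (ptrs \<rho>)"
proof (induction \<rho>)
  case empty
  show ?case by (rule bdd_meas_cong[of "\<lambda>_. 1"]) auto
next
  case (add k \<rho>)
  show ?case by (rule bdd_meas_cong[OF bdd_meas_mult[OF bdd_meas_ptr[of k] add]]) auto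
qed

lemma ptr_0: "g \<in> unitary_group N \<Longrightarrow> ptr 0 g = of_nat N"
  using unitary_group_carrier[of g N] by (simp add: ptr_def)

lemma norm_ptr_le: "g \<in> unitary_group N \<Longrightarrow> cmod (ptr k g) \<le> real N"
proof -
  assume g: "g \<in> unitary_group N"
  have "cmod (ptr k g) \<le> (\<Sum>a<N. cmod ((g ^\<^sub>m k) $$ (a, a)))"
    unfolding ptr_def by (rule norm_sum)
  also have "\<dots> \<le> (\<Sum>a<N. 1)"
    using unitary_entry_le_1[OF pow_in_unitary_group[OF g]] by (intro sum_mono) auto
  finally show ?thesis by simp
qed

lemma norm_ptrs_le: "g \<in> unitary_group N \<Longrightarrow> cmod (ptrs \<rho> g) \<le> real N ^ size \<rho>"
  by (induction \<rho>) (auto simp: norm_mult intro!: mult_mono norm_ptr_le)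

end

section \<open>Integration by parts\<close>

text \<open>Orthogonal projections: exp (i t P) = 1 + (exp (i t) - 1) P is then a closed formula, so
  one-parameter subgroups come without a matrix exponential series.\<close>

definition proj_mat :: "nat \<Rightarrow> complex mat \<Rightarrow> bool" where
  "proj_mat N P \<longleftrightarrow> P \<in> carrier_mat N N \<and> P * P = P \<and> mat_adjoint P = P"

text \<open>The one-parameter unitary group with infinitesimal generator \<^term>\<open>\<i> \<cdot>\<^sub>m P\<close>.\<close>
definition proj_flow :: "nat \<Rightarrow> complex mat \<Rightarrow> real \<Rightarrow> complex mat" where
  "proj_flow N P t = 1\<^sub>m N + (cis t - 1) \<cdot>\<^sub>m P"

lemma proj_flow_carrier: "proj_mat N P \<Longrightarrow> proj_flow N P t \<in> carrier_mat N N"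
  by (auto simp: proj_flow_def proj_mat_def)

lemma proj_flow_0: "proj_mat N P \<Longrightarrow> proj_flow N P 0 = 1\<^sub>m N"
  by (intro eq_matI) (auto simp: proj_flow_def proj_mat_def)

text \<open>As P is idempotent, the coefficients a = cis s - 1 and b = cis t - 1 combine to a + b +
  a b = cis (s + t) - 1.\<close>

lemma proj_flow_add:
  assumes P: "proj_mat N P"
  shows "proj_flow N P s * proj_flow N P t = proj_flow N P (s + t)"
proof (rule eq_matI)
  have c: "P \<in> carrier_mat N N" and PP: "P * P = P" using P by (auto simp: proj_mat_def)
  fix i j assume "i < dim_row (proj_flow N P (s + t))" "j < dim_col (proj_flow N P (s + t))"
  then have ij: "i < N" "j < N" using proj_flow_carrier[OF P, of "s + t"] by auto
  have e: "proj_flow N P t $$ (i, j) = (if i = j then 1 else 0) + (cis t - 1) * P $$ (i, j)"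
    if "i < N" "j < N" for t i j using that c by (auto simp: proj_flow_def)
  have PPe: "(\<Sum>k<N. P $$ (i, k) * P $$ (k, j)) = P $$ (i, j)"
    using mult_mat_entry[OF c c ij] PP by simp
  have "(proj_flow N P s * proj_flow N P t) $$ (i, j)
      = (\<Sum>k<N. ((if i = k then 1 else 0) + (cis s - 1) * P $$ (i, k)) * ((if k = j then 1 else 0) + (cis t - 1) * P $$ (k, j)))"
    using ij by (subst mult_mat_entry[OF proj_flow_carrier[OF P] proj_flow_carrier[OF P]]) (auto simp: e)
  also have "\<dots> = (\<Sum>k<N. if i = k then (if k = j then 1 else 0) + (cis t - 1) * P $$ (k, j) else 0)
     + (\<Sum>k<N. if k = j then (cis s - 1) * P $$ (i, k) else 0)
     + (cis s - 1) * (cis t - 1) * (\<Sum>k<N. P $$ (i, k) * P $$ (k, j))"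
    unfolding sum_distrib_left sum.distrib[symmetric] by (intro sum.cong) (auto simp: algebra_simps)
  also have "\<dots> = (if i = j then 1 else 0) + (cis (s + t) - 1) * P $$ (i, j)"
    unfolding PPe using ij by (simp add: cis_mult[symmetric] algebra_simps)
  finally show "(proj_flow N P s * proj_flow N P t) $$ (i, j) = proj_flow N P (s + t) $$ (i, j)"
    using ij by (simp add: e)
qed (use P in \<open>auto simp: proj_flow_def proj_mat_def\<close>)

lemma adjoint_proj_flow:
  assumes P: "proj_mat N P"
  shows "mat_adjoint (proj_flow N P t) = proj_flow N P (- t)"
proof (rule eq_matI)
  have c: "P \<in> carrier_mat N N" and PP: "mat_adjoint P = P" using P by (auto simp: proj_mat_def)
  fix i j assume "i < dim_row (proj_flow N P (- t))" "j < dim_col (proj_flow N P (- t))"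
  then have ij: "i < N" "j < N" using proj_flow_carrier[OF P, of "- t"] by auto
  have "cnj (P $$ (j, i)) = P $$ (i, j)" using mat_adjoint_entry[OF c ij] PP by simp
  then show "mat_adjoint (proj_flow N P t) $$ (i, j) = proj_flow N P (- t) $$ (i, j)"
    using ij c by (auto simp: mat_adjoint_entry[OF proj_flow_carrier[OF P]]) (auto simp: proj_flow_def cis_cnj)
qed (use P in \<open>auto simp: proj_flow_def proj_mat_def\<close>)

lemma proj_flow_unitary:
  assumes P: "proj_mat N P"
  shows "proj_flow N P t \<in> unitary_group N"
  using proj_flow_carrier[OF P] proj_flow_0[OF P]
  by (simp add: unitary_group_def adjoint_proj_flow[OF P] proj_flow_add[OF P])

lemma rank_one_proj_mat:
  assumes v: "(\<Sum>a<N. v a * cnj (v a)) = 1"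
  shows "proj_mat N (mat N N (\<lambda>(a, b). v a * cnj (v b)))"
proof -
  let ?P = "mat N N (\<lambda>(a, b). v a * cnj (v b))"
  have c: "?P \<in> carrier_mat N N" by simp
  have "?P * ?P = ?P"
  proof (rule eq_matI)
    fix i j assume "i < dim_row ?P" "j < dim_col ?P"
    then have ij: "i < N" "j < N" by auto
    have "(?P * ?P) $$ (i, j) = (\<Sum>k<N. v i * cnj (v j) * (v k * cnj (v k)))"
      unfolding mult_mat_entry[OF c c ij] using ij by (intro sum.cong) auto
    also have "\<dots> = ?P $$ (i, j)" using ij by (simp add: sum_distrib_left[symmetric] v)
    finally show "(?P * ?P) $$ (i, j) = ?P $$ (i, j)" .
  qed auto
  moreover have "mat_adjoint ?P = ?P"
    by (rule eq_matI) (auto simp: mat_adjoint_entry[OF c])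
  ultimately show ?thesis by (simp add: proj_mat_def)
qed

text \<open>Dominated convergence is applied to sequences, so the difference quotient is sampled at
  1/(n + 1).\<close>

lemma has_vector_derivative_imp_seq_quotient:
  fixes f :: "real \<Rightarrow> complex"
  assumes "(f has_vector_derivative D) (at 0)"
  shows "(\<lambda>n. (f (1 / real (Suc n)) - f 0) * of_nat (Suc n)) \<longlonglongrightarrow> D"
proof -
  have "(\<lambda>h. norm (f (0 + h) - f 0 - h *\<^sub>R D) / norm h) \<midarrow>0\<rightarrow> 0"
    using assms unfolding has_vector_derivative_def has_derivative_at by auto
  moreover have "filterlim (\<lambda>n. 1 / real (Suc n)) (at 0) sequentially"
    using LIMSEQ_Suc[OF lim_1_over_n[where 'a = real]]
    by (auto simp: filterlim_at)
  ultimately have "(\<lambda>n. norm (f (0 + 1 / real (Suc n)) - f 0 - (1 / real (Suc n)) *\<^sub>R D) / norm (1 / real (Suc n))) \<longlonglongrightarrow> 0"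
    by (rule filterlim_compose)
  moreover have "norm (f (0 + 1 / real (Suc n)) - f 0 - (1 / real (Suc n)) *\<^sub>R D) / norm (1 / real (Suc n))
      = norm ((f (1 / real (Suc n)) - f 0) * of_nat (Suc n) - D)" for n
  proof -
    have "(f (1 / real (Suc n)) - f 0) * of_nat (Suc n) - D
        = (f (0 + 1 / real (Suc n)) - f 0 - (1 / real (Suc n)) *\<^sub>R D) * of_nat (Suc n)"
      by (simp add: scaleR_conv_of_real field_simps del: of_nat_Suc)
    then show ?thesis by (simp add: norm_mult del: of_nat_Suc)
  qed
  ultimately have "(\<lambda>n. norm ((f (1 / real (Suc n)) - f 0) * of_nat (Suc n) - D)) \<longlonglongrightarrow> 0"
    by simp
  then show ?thesis using tendsto_norm_zero_iff LIM_zero_iff by blast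
qed

context haar_unitary
begin

text \<open>
  \<^term>\<open>f' c d\<close> is the derivative of \<^term>\<open>f\<close> under left multiplication in the direction of the
  matrix unit at \<^term>\<open>(c, d)\<close>, which lies in the complexified Lie algebra only; the condition
  below tests it on the generators \<^term>\<open>\<i> \<cdot>\<^sub>m P\<close>, whose complex span is everything.
\<close>
definition left_deriv :: "(complex mat \<Rightarrow> complex) \<Rightarrow> (nat \<Rightarrow> nat \<Rightarrow> complex mat \<Rightarrow> complex) \<Rightarrow> bool" where
  "left_deriv f f' \<longleftrightarrow> bdd_meas f \<and> (\<forall>c<N. \<forall>d<N. bdd_meas (f' c d)) \<and>
     (\<forall>P g. proj_mat N P \<longrightarrow> g \<in> unitary_group N \<longrightarrow>
        ((\<lambda>t. f (proj_flow N P t * g)) has_vector_derivative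
           (\<Sum>c<N. \<Sum>d<N. \<i> * P $$ (c, d) * f' c d g)) (at 0))"

text \<open>By invariance the integral of \<open>f (proj_flow N P t * g)\<close> over g does not
  depend on t, so the difference quotients integrate to 0. Passing to the limit under the integral
  requires a bound on the quotients uniform in g.\<close>

lemma left_deriv_integral_proj:
  assumes f: "left_deriv f f'" and P: "proj_mat N P"
  shows "(\<Sum>c<N. \<Sum>d<N. P $$ (c, d) * (\<integral>g. f' c d g \<partial>\<mu>)) = 0"
proof -
  define D where "D g = (\<Sum>c<N. \<Sum>d<N. \<i> * P $$ (c, d) * f' c d g)" for g
  define F where "F g t = f (proj_flow N P t * g)" for g t
  have bm: "bdd_meas f" "\<And>c d. c < N \<Longrightarrow> d < N \<Longrightarrow> bdd_meas (f' c d)"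
    using f by (auto simp: left_deriv_def)
  have bD: "bdd_meas D" unfolding D_def[abs_def]
    using bm by (intro bdd_meas_sum bdd_meas_mult) auto
  then obtain B where B: "\<And>g. g \<in> unitary_group N \<Longrightarrow> cmod (D g) \<le> B" by (auto simp: bdd_meas_def)
  have flow: "proj_flow N P t * g \<in> unitary_group N" if "g \<in> unitary_group N" for t g
    using proj_flow_unitary[OF P] that by (rule mult_in_unitary_group)
  have der0: "(F g has_vector_derivative D g) (at 0)" if "g \<in> unitary_group N" for g
    using f P that unfolding left_deriv_def F_def[abs_def] D_def by auto
  \<comment> \<open>The flow is a group, so the derivative at time t is the derivative at time 0 at
    the translated point. Hence the bound B holds along the whole curve.\<close>
  have shift: "F g (s + t) = F (proj_flow N P t * g) s" if "g \<in> unitary_group N" for s t g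
    unfolding F_def
    using proj_flow_carrier[OF P] unitary_group_carrier[OF that]
    by (simp add: proj_flow_add[OF P, symmetric] assoc_mult_mat[of _ N N _ N _ N])
  have der: "(F g has_vector_derivative D (proj_flow N P t * g)) (at t)" if g: "g \<in> unitary_group N" for g t
  proof -
    have "(F (proj_flow N P t * g) has_vector_derivative D (proj_flow N P t * g)) (at (t - t))"
      using der0[OF flow[OF g]] by simp
    then have "((F (proj_flow N P t * g) \<circ> (\<lambda>s. s - t)) has_vector_derivative 1 *\<^sub>R D (proj_flow N P t * g)) (at t)"
      by (intro vector_diff_chain_at) (auto intro!: derivative_eq_intros)
    moreover have "F (proj_flow N P t * g) \<circ> (\<lambda>s. s - t) = F g"
      using shift[OF g, of "_ - t" t] by (auto simp: fun_eq_iff)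
    ultimately show ?thesis by simp
  qed
  have F0: "F g 0 = f g" if "g \<in> unitary_group N" for g
    using proj_flow_0[OF P] unitary_group_carrier[OF that] by (simp add: F_def)
  \<comment> \<open>The mean value inequality turns B into a dominating constant for the
    quotients.\<close>
  have lip: "norm (F g t - F g 0) \<le> B * norm (t - 0)" if g: "g \<in> unitary_group N" for g t
  proof (rule differentiable_bound[of UNIV "F g" "\<lambda>t h. h *\<^sub>R D (proj_flow N P t * g)"])
    fix t :: real
    show "(F g has_derivative (\<lambda>h. h *\<^sub>R D (proj_flow N P t * g))) (at t within UNIV)"
      using der[OF g, of t] by (simp add: has_vector_derivative_def)
    show "onorm (\<lambda>h. h *\<^sub>R D (proj_flow N P t * g)) \<le> B"
      using B[OF flow[OF g], of t] by (intro onorm_le) (auto simp: mult.commute[of B] intro!: mult_left_mono)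
  qed auto
  define q where "q n g = (F g (1 / real (Suc n)) - F g 0) * of_nat (Suc n)" for n g
  have measF: "(\<lambda>g. F g t) \<in> borel_measurable \<mu>" for t
    unfolding F_def using measurable_mult[OF proj_flow_unitary[OF P]] bm(1)
    by (auto simp: bdd_meas_def intro: measurable_compose)
  have "(\<lambda>n. \<integral>g. q n g \<partial>\<mu>) \<longlonglongrightarrow> (\<integral>g. D g \<partial>\<mu>)"
  proof (rule integral_dominated_convergence[where w = "\<lambda>_. B"])
    show "D \<in> borel_measurable \<mu>" using bD by (simp add: bdd_meas_def)
    show "q n \<in> borel_measurable \<mu>" for n unfolding q_def[abs_def] using measF by auto
    show "AE g in \<mu>. (\<lambda>n. q n g) \<longlonglongrightarrow> D g"
      unfolding q_def by (intro AE_I2 has_vector_derivative_imp_seq_quotient der0) simp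
    show "AE g in \<mu>. norm (q n g) \<le> B" for n
    proof (intro AE_I2)
      fix g assume "g \<in> space \<mu>"
      then have "norm (F g (1 / real (Suc n)) - F g 0) \<le> B * (1 / real (Suc n))"
        using lip[of g "1 / real (Suc n)"] by simp
      then show "norm (q n g) \<le> B" unfolding q_def norm_mult norm_of_nat
        by (simp add: field_simps del: of_nat_Suc)
    qed
  qed auto
  moreover have "(\<integral>g. q n g \<partial>\<mu>) = 0" for n
  proof -
    have i1: "(\<integral>g. F g t \<partial>\<mu>) = (\<integral>g. f g \<partial>\<mu>)" for t
      unfolding F_def using integral_mult[OF proj_flow_unitary[OF P]] bm(1) by (auto simp: bdd_meas_def)
    have "bdd_meas (\<lambda>g. F g t)" for t
      using bm(1) measF[of t] flow unfolding bdd_meas_def F_def by blast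
    then have "(\<integral>g. F g (1 / real (Suc n)) - F g 0 \<partial>\<mu>) = 0"
      by (subst Bochner_Integration.integral_diff) (auto intro: bdd_meas_integrable simp: i1)
    then show ?thesis unfolding q_def by (simp del: of_nat_Suc)
  qed
  ultimately have "(\<integral>g. D g \<partial>\<mu>) = 0"
    by (simp add: LIMSEQ_const_iff)
  moreover have "(\<integral>g. D g \<partial>\<mu>) = \<i> * (\<Sum>c<N. \<Sum>d<N. P $$ (c, d) * (\<integral>g. f' c d g \<partial>\<mu>))"
  proof -
    have int: "integrable \<mu> (\<lambda>g. \<i> * P $$ (c, d) * f' c d g)" if "c < N" "d < N" for c d
      using bm(2)[OF that] by (intro integrable_mult_right bdd_meas_integrable)
    have "(\<integral>g. D g \<partial>\<mu>) = (\<Sum>c<N. (\<integral>g. (\<Sum>d<N. \<i> * P $$ (c, d) * f' c d g) \<partial>\<mu>))"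
      unfolding D_def using int by (intro Bochner_Integration.integral_sum Bochner_Integration.integrable_sum) auto
    also have "\<dots> = (\<Sum>c<N. \<Sum>d<N. (\<integral>g. \<i> * P $$ (c, d) * f' c d g \<partial>\<mu>))"
      using int by (intro sum.cong Bochner_Integration.integral_sum) auto
    finally have "(\<integral>g. D g \<partial>\<mu>) = (\<Sum>c<N. \<Sum>d<N. \<i> * P $$ (c, d) * (\<integral>g. f' c d g \<partial>\<mu>))"
      by simp
    then show ?thesis by (simp add: sum_distrib_left mult.assoc)
  qed
  ultimately show ?thesis by simp
qed

text \<open>Rank-one projections make the integrals, as a sesquilinear form in c and d, vanish on
  the diagonal of unit vectors; polarization then isolates a single entry.\<close>

lemma left_deriv_integral:
  assumes f: "left_deriv f f'" and cd: "c < N" "d < N"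
  shows "(\<integral>g. f' c d g \<partial>\<mu>) = 0"
proof -
  define L where "L c d = (\<integral>g. f' c d g \<partial>\<mu>)" for c d
  have v: "(\<Sum>a<N. \<Sum>b<N. v a * cnj (v b) * L a b) = 0" if "(\<Sum>a<N. v a * cnj (v a)) = 1" for v
    using left_deriv_integral_proj[OF f rank_one_proj_mat[OF that]] unfolding L_def by simp
  have diag: "L a a = 0" if "a < N" for a
  proof -
    let ?e = "\<lambda>x. if x = a then 1 else 0 :: complex"
    have "(\<Sum>x<N. ?e x * cnj (?e x)) = (\<Sum>x<N. ?e x)" by (intro sum.cong) auto
    also have "\<dots> = 1" using that by simp
    finally have "0 = (\<Sum>x<N. \<Sum>y<N. ?e x * cnj (?e y) * L x y)" using v by simp
    also have "\<dots> = (\<Sum>x<N. if x = a then (\<Sum>y<N. if y = a then L x y else 0) else 0)"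
    proof (intro sum.cong refl)
      fix x assume "x \<in> {..<N}"
      have "?e x * cnj (?e y) * L x y = (if x = a then (if y = a then L x y else 0) else 0)" for y by auto
      then show "(\<Sum>y<N. ?e x * cnj (?e y) * L x y) = (if x = a then (\<Sum>y<N. if y = a then L x y else 0) else 0)"
        by simp
    qed
    finally show ?thesis using that by simp
  qed
  show ?thesis
  proof (cases "c = d")
    case True
    then show ?thesis using diag cd by (simp add: L_def)
  next
    case False
    \<comment> \<open>The unit vector has entries 1 / sqrt 2 at c and \<omega> / sqrt 2 at d. The
      diagonal terms vanish by \<open>diag\<close>, which leaves the two cross terms.\<close>
    have pol: "cnj \<omega> * L c d + \<omega> * L d c = 0" if \<omega>: "\<omega> * cnj \<omega> = 1" for \<omega>
    proof -
      define v where "v a = (if a = c then 1 / complex_of_real (sqrt 2) else 0) + (if a = d then \<omega> / complex_of_real (sqrt 2) else 0)" for a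
      have h: "1 / complex_of_real (sqrt 2) * (1 / complex_of_real (sqrt 2)) = 1 / 2"
        by (simp flip: of_real_mult)
      have sumv: "(\<Sum>a<N. v a * X a) = (X c + \<omega> * X d) / complex_of_real (sqrt 2)" for X
      proof -
        have "(\<Sum>a<N. v a * X a) = (\<Sum>a<N. if a = c then X a / complex_of_real (sqrt 2) else 0) + (\<Sum>a<N. if a = d then \<omega> * X a / complex_of_real (sqrt 2) else 0)"
          unfolding sum.distrib[symmetric] v_def by (intro sum.cong) (auto simp: algebra_simps)
        then show ?thesis using cd by (simp add: add_divide_distrib)
      qed
      have sumv': "(\<Sum>a<N. cnj (v a) * X a) = (X c + cnj \<omega> * X d) / complex_of_real (sqrt 2)" for X
        using arg_cong[OF sumv[of "\<lambda>a. cnj (X a)"], of cnj] by simp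
      have vc: "v c = 1 / complex_of_real (sqrt 2)" "v d = \<omega> / complex_of_real (sqrt 2)"
        using False by (auto simp: v_def)
      have "(\<Sum>a<N. v a * cnj (v a)) = (1 + \<omega> * cnj \<omega>) * (1 / complex_of_real (sqrt 2) * (1 / complex_of_real (sqrt 2)))"
        unfolding sumv vc by (simp add: algebra_simps add_divide_distrib)
      then have "(\<Sum>a<N. v a * cnj (v a)) = 1" unfolding h \<omega> by simp
      from v[OF this] have "0 = (\<Sum>a<N. v a * (\<Sum>b<N. cnj (v b) * L a b))"
        by (simp add: sum_distrib_left mult.assoc)
      also have "\<dots> = (L c c + cnj \<omega> * L c d + \<omega> * (L d c + cnj \<omega> * L d d)) * (1 / complex_of_real (sqrt 2) * (1 / complex_of_real (sqrt 2)))"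
        unfolding sumv sumv' by (simp add: algebra_simps add_divide_distrib)
      finally show ?thesis unfolding h using diag cd by simp
    qed
    \<comment> \<open>\<omega> = \<i> makes the two off-diagonal integrals equal, \<omega> = 1 makes
      their sum zero.\<close>
    have "L d c = L c d" using pol[of \<i>] by simp
    with pol[of 1] have "L c d = 0" by simp
    then show ?thesis by (simp add: L_def)
  qed
qed

end

section \<open>Calculus of left derivatives: entries, powers and power sums\<close>

lemma pow_mat_add:
  assumes "A \<in> carrier_mat n n"
  shows "A ^\<^sub>m (k + l) = A ^\<^sub>m k * A ^\<^sub>m l"
proof (induction l)
  case 0
  then show ?case using assms by (simp add: right_mult_one_mat[of _ n n])
next
  case (Suc l)
  then show ?case using assms by (simp add: assoc_mult_mat[of _ n n _ n _ n])
qed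

context haar_unitary
begin

lemma left_derivD:
  assumes "left_deriv f f'"
  shows "bdd_meas f" "c < N \<Longrightarrow> d < N \<Longrightarrow> bdd_meas (f' c d)"
    "proj_mat N P \<Longrightarrow> g \<in> unitary_group N \<Longrightarrow> ((\<lambda>t. f (proj_flow N P t * g)) has_vector_derivative
           (\<Sum>c<N. \<Sum>d<N. \<i> * P $$ (c, d) * f' c d g)) (at 0)"
  using assms unfolding left_deriv_def by blast+

lemma left_deriv_cong:
  assumes f: "left_deriv f f'" and eq: "\<And>g. g \<in> unitary_group N \<Longrightarrow> f g = h g"
    and eq': "\<And>c d g. c < N \<Longrightarrow> d < N \<Longrightarrow> g \<in> unitary_group N \<Longrightarrow> f' c d g = h' c d g"
  shows "left_deriv h h'"
  unfolding left_deriv_def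
proof (intro conjI allI impI)
  show "bdd_meas h" by (rule bdd_meas_cong[OF left_derivD(1)[OF f] eq])
  show "bdd_meas (h' c d)" if "c < N" "d < N" for c d
    by (rule bdd_meas_cong[OF left_derivD(2)[OF f that] eq'[OF that]])
  fix P g assume P: "proj_mat N P" and g: "g \<in> unitary_group N"
  have "f (proj_flow N P t * g) = h (proj_flow N P t * g)" for t
    by (rule eq[OF mult_in_unitary_group[OF proj_flow_unitary[OF P] g]])
  moreover have "(\<Sum>c<N. \<Sum>d<N. \<i> * P $$ (c, d) * f' c d g) = (\<Sum>c<N. \<Sum>d<N. \<i> * P $$ (c, d) * h' c d g)"
    by (intro sum.cong refl arg_cong2[where f = "(*)"] eq' g) auto
  ultimately show "((\<lambda>t. h (proj_flow N P t * g)) has_vector_derivative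
           (\<Sum>c<N. \<Sum>d<N. \<i> * P $$ (c, d) * h' c d g)) (at 0)"
    using left_derivD(3)[OF f P g] by simp
qed

lemma left_deriv_const: "left_deriv (\<lambda>_. z) (\<lambda>c d g. 0)"
  by (auto simp: left_deriv_def)

lemma left_deriv_mult:
  assumes f: "left_deriv f f'" and h: "left_deriv h h'"
  shows "left_deriv (\<lambda>g. f g * h g) (\<lambda>c d g. f g * h' c d g + f' c d g * h g)"
proof -
  have "((\<lambda>t. f (proj_flow N P t * g) * h (proj_flow N P t * g)) has_vector_derivative
           (\<Sum>c<N. \<Sum>d<N. \<i> * P $$ (c, d) * (f g * h' c d g + f' c d g * h g))) (at 0)"
    if P: "proj_mat N P" and g: "g \<in> unitary_group N" for P g
  proof -
    have 0: "proj_flow N P 0 * g = g" using proj_flow_0[OF P] unitary_group_carrier[OF g] by simp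
    have "(\<Sum>c<N. \<Sum>d<N. \<i> * P $$ (c, d) * (f g * h' c d g + f' c d g * h g))
       = f g * (\<Sum>c<N. \<Sum>d<N. \<i> * P $$ (c, d) * h' c d g) + (\<Sum>c<N. \<Sum>d<N. \<i> * P $$ (c, d) * f' c d g) * h g"
      unfolding sum_distrib_left sum_distrib_right sum.distrib[symmetric]
      by (intro sum.cong refl) (simp add: algebra_simps)
    moreover have "((\<lambda>t. f (proj_flow N P t * g)) has_vector_derivative
           (\<Sum>c<N. \<Sum>d<N. \<i> * P $$ (c, d) * f' c d g)) (at 0)"
      "((\<lambda>t. h (proj_flow N P t * g)) has_vector_derivative
           (\<Sum>c<N. \<Sum>d<N. \<i> * P $$ (c, d) * h' c d g)) (at 0)"
      using f h P g by (auto simp: left_deriv_def)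
    note has_vector_derivative_mult[OF this]
    ultimately show ?thesis by (simp add: 0)
  qed
  then show ?thesis using f h by (auto simp: left_deriv_def intro!: bdd_meas_mult bdd_meas_add)
qed

lemma left_deriv_sum:
  assumes "\<And>x. x \<in> A \<Longrightarrow> left_deriv (f x) (f' x)"
  shows "left_deriv (\<lambda>g. \<Sum>x\<in>A. f x g) (\<lambda>c d g. \<Sum>x\<in>A. f' x c d g)"
proof -
  have "((\<lambda>t. \<Sum>x\<in>A. f x (proj_flow N P t * g)) has_vector_derivative
           (\<Sum>c<N. \<Sum>d<N. \<i> * P $$ (c, d) * (\<Sum>x\<in>A. f' x c d g))) (at 0)"
    if P: "proj_mat N P" and g: "g \<in> unitary_group N" for P g
  proof -
    have "((\<lambda>t. \<Sum>x\<in>A. f x (proj_flow N P t * g)) has_vector_derivative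
           (\<Sum>x\<in>A. \<Sum>c<N. \<Sum>d<N. \<i> * P $$ (c, d) * f' x c d g)) (at 0)"
      using assms P g by (intro has_vector_derivative_sum) (auto simp: left_deriv_def)
    also have "(\<Sum>x\<in>A. \<Sum>c<N. \<Sum>d<N. \<i> * P $$ (c, d) * f' x c d g)
        = (\<Sum>c<N. \<Sum>x\<in>A. \<Sum>d<N. \<i> * P $$ (c, d) * f' x c d g)" by (rule sum.swap)
    also have "\<dots> = (\<Sum>c<N. \<Sum>d<N. \<Sum>x\<in>A. \<i> * P $$ (c, d) * f' x c d g)"
      by (intro sum.cong refl sum.swap)
    finally show ?thesis by (simp add: sum_distrib_left)
  qed
  then show ?thesis using assms by (auto simp: left_deriv_def intro!: bdd_meas_sum)
qed

text \<open>Because P is Hermitian, \<open>\<i> * P $$ (c, d)\<close> conjugates to minus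
  \<open>\<i> * P $$ (d, c)\<close>: hence the sign and the exchanged indices.\<close>

lemma left_deriv_cnj:
  assumes f: "left_deriv f f'"
  shows "left_deriv (\<lambda>g. cnj (f g)) (\<lambda>c d g. - cnj (f' d c g))"
proof -
  have "((\<lambda>t. cnj (f (proj_flow N P t * g))) has_vector_derivative
           (\<Sum>c<N. \<Sum>d<N. \<i> * P $$ (c, d) * (- cnj (f' d c g)))) (at 0)"
    if P: "proj_mat N P" and g: "g \<in> unitary_group N" for P g
  proof -
    have PP: "cnj (P $$ (c, d)) = P $$ (d, c)" if "c < N" "d < N" for c d
      using P that mat_adjoint_entry[of P N N d c] by (simp add: proj_mat_def)
    have "((\<lambda>t. cnj (f (proj_flow N P t * g))) has_vector_derivative
           cnj (\<Sum>c<N. \<Sum>d<N. \<i> * P $$ (c, d) * f' c d g)) (at 0)"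
      using f P g by (intro has_vector_derivative_cnj) (auto simp: left_deriv_def)
    also have "cnj (\<Sum>c<N. \<Sum>d<N. \<i> * P $$ (c, d) * f' c d g) = (\<Sum>c<N. \<Sum>d<N. \<i> * P $$ (d, c) * (- cnj (f' c d g)))"
      unfolding cnj_sum by (intro sum.cong refl) (auto simp: PP)
    also have "\<dots> = (\<Sum>d<N. \<Sum>c<N. \<i> * P $$ (d, c) * (- cnj (f' c d g)))" by (rule sum.swap)
    finally show ?thesis .
  qed
  then show ?thesis using f by (auto simp: left_deriv_def intro!: bdd_meas_uminus bdd_meas_cnj)
qed

lemma left_deriv_entry:
  assumes ab: "a < N" "b < N"
  shows "left_deriv (\<lambda>g. g $$ (a, b)) (\<lambda>c d g. if c = a then g $$ (d, b) else 0)"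
proof -
  have "((\<lambda>t. (proj_flow N P t * g) $$ (a, b)) has_vector_derivative
           (\<Sum>c<N. \<Sum>d<N. \<i> * P $$ (c, d) * (if c = a then g $$ (d, b) else 0))) (at 0)"
    if P: "proj_mat N P" and g: "g \<in> unitary_group N" for P g
  proof -
    have c: "P \<in> carrier_mat N N" using P by (simp add: proj_mat_def)
    have "(proj_flow N P t * g) $$ (a, b) = g $$ (a, b) + (cis t - 1) * (\<Sum>k<N. P $$ (a, k) * g $$ (k, b))" for t
    proof -
      have "(proj_flow N P t * g) $$ (a, b) = (\<Sum>k<N. (if k = a then g $$ (k, b) else 0) + (cis t - 1) * (P $$ (a, k) * g $$ (k, b)))"
        unfolding mult_mat_entry[OF proj_flow_carrier[OF P] unitary_group_carrier[OF g] ab]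
        using c ab by (intro sum.cong) (auto simp: proj_flow_def algebra_simps)
      then show ?thesis using ab by (simp add: sum.distrib sum_distrib_left)
    qed
    moreover have "((\<lambda>t. g $$ (a, b) + (cis t - 1) * (\<Sum>k<N. P $$ (a, k) * g $$ (k, b))) has_vector_derivative
        (0 + (\<i> * cis 0 - 0) * (\<Sum>k<N. P $$ (a, k) * g $$ (k, b)))) (at 0)"
    proof (intro has_vector_derivative_add has_vector_derivative_mult_left has_vector_derivative_diff has_vector_derivative_const)
      have "((\<lambda>x. exp (\<i> * complex_of_real x)) has_vector_derivative \<i> * cis 0) (at 0)"
        by (rule has_vector_derivative_real_field) (auto intro!: derivative_eq_intros)
      then show "(cis has_vector_derivative \<i> * cis 0) (at 0)" by (simp add: cis_conv_exp[abs_def])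
    qed
    moreover have "(\<Sum>c<N. \<Sum>d<N. \<i> * P $$ (c, d) * (if c = a then g $$ (d, b) else 0))
        = (\<Sum>c<N. if c = a then (\<Sum>d<N. \<i> * P $$ (c, d) * g $$ (d, b)) else 0)"
      by (intro sum.cong) auto
    ultimately show ?thesis using ab by (simp add: sum_distrib_left mult.assoc)
  qed
  moreover have "bdd_meas (\<lambda>g. if c = a then g $$ (d, b) else 0)" if "c < N" "d < N" for c d
    using that ab by (cases "c = a") auto
  ultimately show ?thesis using ab by (auto simp: left_deriv_def)
qed

text \<open>Product rule for noncommuting factors: the matrix unit is inserted in front of each of
  the k factors in turn and cuts the power into exponents j and k - j.\<close>

lemma left_deriv_pow_entry:
  assumes ab: "a < N" "b < N"
  shows "left_deriv (\<lambda>g. (g ^\<^sub>m k) $$ (a, b)) (\<lambda>c d g. \<Sum>j<k. (g ^\<^sub>m j) $$ (a, c) * (g ^\<^sub>m (k - j)) $$ (d, b))"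
  using ab
proof (induction k arbitrary: b)
  case 0
  show ?case
    by (rule left_deriv_cong[OF left_deriv_const[of "if a = b then 1 else 0"]])
      (use 0 in \<open>auto dest!: unitary_group_carrier\<close>)
next
  case (Suc k)
  have "left_deriv (\<lambda>g. \<Sum>e<N. (g ^\<^sub>m k) $$ (a, e) * g $$ (e, b))
     (\<lambda>c d g. \<Sum>e<N. (g ^\<^sub>m k) $$ (a, e) * (if c = e then g $$ (d, b) else 0) +
         (\<Sum>j<k. (g ^\<^sub>m j) $$ (a, c) * (g ^\<^sub>m (k - j)) $$ (d, e)) * g $$ (e, b))"
    using Suc by (intro left_deriv_sum left_deriv_mult left_deriv_entry Suc.IH) auto
  then show ?case
  proof (rule left_deriv_cong)
    fix g assume "g \<in> unitary_group N"
    then show "(\<Sum>e<N. (g ^\<^sub>m k) $$ (a, e) * g $$ (e, b)) = (g ^\<^sub>m Suc k) $$ (a, b)"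
      using pow_Suc_entry Suc.prems by metis
  next
    fix c d g assume c: "c < N" and d: "d < N" and g: "g \<in> unitary_group N"
    have "(\<Sum>e<N. (g ^\<^sub>m k) $$ (a, e) * (if c = e then g $$ (d, b) else 0)) = (\<Sum>e<N. if c = e then (g ^\<^sub>m k) $$ (a, e) * g $$ (d, b) else 0)"
      by (intro sum.cong) auto
    also have "\<dots> = (g ^\<^sub>m k) $$ (a, c) * (g ^\<^sub>m (Suc k - k)) $$ (d, b)"
      using c unitary_group_carrier[OF g] by simp
    finally have 1: "(\<Sum>e<N. (g ^\<^sub>m k) $$ (a, e) * (if c = e then g $$ (d, b) else 0)) = \<dots>" .
    have "(\<Sum>e<N. (\<Sum>j<k. (g ^\<^sub>m j) $$ (a, c) * (g ^\<^sub>m (k - j)) $$ (d, e)) * g $$ (e, b))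
       = (\<Sum>j<k. (g ^\<^sub>m j) $$ (a, c) * (\<Sum>e<N. (g ^\<^sub>m (k - j)) $$ (d, e) * g $$ (e, b)))"
      unfolding sum_distrib_left sum_distrib_right by (subst sum.swap) (simp add: mult.assoc)
    also have "\<dots> = (\<Sum>j<k. (g ^\<^sub>m j) $$ (a, c) * (g ^\<^sub>m (Suc k - j)) $$ (d, b))"
      using pow_Suc_entry[OF g d Suc.prems(2)] by (intro sum.cong refl) (simp add: Suc_diff_le del: pow_mat.simps)
    finally show "(\<Sum>e<N. (g ^\<^sub>m k) $$ (a, e) * (if c = e then g $$ (d, b) else 0) +
         (\<Sum>j<k. (g ^\<^sub>m j) $$ (a, c) * (g ^\<^sub>m (k - j)) $$ (d, e)) * g $$ (e, b))
       = (\<Sum>j<Suc k. (g ^\<^sub>m j) $$ (a, c) * (g ^\<^sub>m (Suc k - j)) $$ (d, b))"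
      by (simp only: sum.distrib 1 sum.lessThan_Suc add.commute)
  qed
qed

lemma pow_mult_entry:
  assumes "g \<in> unitary_group N" "a < N" "b < N"
  shows "(\<Sum>e<N. (g ^\<^sub>m k) $$ (a, e) * (g ^\<^sub>m l) $$ (e, b)) = (g ^\<^sub>m (k + l)) $$ (a, b)"
  using assms mult_mat_entry[of "g ^\<^sub>m k" N N "g ^\<^sub>m l" N a b] pow_mat_add[of g N k l] unitary_group_carrier[of g N]
  by simp

text \<open>By cyclicity of the trace all k insertions give the same contribution.\<close>

lemma left_deriv_ptr: "left_deriv (ptr k) (\<lambda>c d g. of_nat k * (g ^\<^sub>m k) $$ (d, c))"
proof (rule left_deriv_cong)
  show "left_deriv (\<lambda>g. \<Sum>a<N. (g ^\<^sub>m k) $$ (a, a))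
      (\<lambda>c d g. \<Sum>a<N. \<Sum>j<k. (g ^\<^sub>m j) $$ (a, c) * (g ^\<^sub>m (k - j)) $$ (d, a))"
    by (intro left_deriv_sum left_deriv_pow_entry) auto
  fix c d g assume c: "c < N" and d: "d < N" and g: "g \<in> unitary_group N"
  have "(\<Sum>a<N. \<Sum>j<k. (g ^\<^sub>m j) $$ (a, c) * (g ^\<^sub>m (k - j)) $$ (d, a))
     = (\<Sum>j<k. \<Sum>a<N. (g ^\<^sub>m (k - j)) $$ (d, a) * (g ^\<^sub>m j) $$ (a, c))"
    by (subst sum.swap) (simp add: mult.commute)
  also have "\<dots> = (\<Sum>j<k. (g ^\<^sub>m k) $$ (d, c))"
    using pow_mult_entry[OF g d c] by (intro sum.cong) auto
  finally show "(\<Sum>a<N. \<Sum>j<k. (g ^\<^sub>m j) $$ (a, c) * (g ^\<^sub>m (k - j)) $$ (d, a)) = of_nat k * (g ^\<^sub>m k) $$ (d, c)"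
    by simp
qed (simp add: ptr_def)

lemma left_deriv_ptrs:
  "left_deriv (ptrs \<rho>) (\<lambda>c d g. \<Sum>l\<in>#\<rho>. of_nat l * (g ^\<^sub>m l) $$ (d, c) * ptrs (\<rho> - {#l#}) g)"
proof (induction \<rho>)
  case empty
  show ?case by (rule left_deriv_cong[OF left_deriv_const[of 1]]) auto
next
  case (add k \<rho>)
  show ?case
  proof (rule left_deriv_cong[OF left_deriv_mult[OF left_deriv_ptr[of k] add]])
    fix c d g
    have "(\<Sum>l\<in>#\<rho>. of_nat l * (g ^\<^sub>m l) $$ (d, c) * ptrs (add_mset k \<rho> - {#l#}) g)
       = (\<Sum>l\<in>#\<rho>. ptr k g * (of_nat l * (g ^\<^sub>m l) $$ (d, c) * ptrs (\<rho> - {#l#}) g))"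
      by (intro arg_cong[where f = sum_mset] image_mset_cong) (auto dest!: multi_member_split)
    then show "ptr k g * (\<Sum>l\<in>#\<rho>. of_nat l * (g ^\<^sub>m l) $$ (d, c) * ptrs (\<rho> - {#l#}) g)
        + of_nat k * (g ^\<^sub>m k) $$ (d, c) * ptrs \<rho> g
       = (\<Sum>l\<in>#add_mset k \<rho>. of_nat l * (g ^\<^sub>m l) $$ (d, c) * ptrs (add_mset k \<rho> - {#l#}) g)"
      by (simp add: sum_mset_distrib_left multiset.map_comp o_def)
  qed simp
qed

text \<open>The double sum is the trace of the k-th power times the adjoint of the l-th power, and
  that adjoint is an inverse.\<close>

lemma sum_pow_cnj_pow:
  assumes g: "g \<in> unitary_group N" and "l \<le> k"
  shows "(\<Sum>a<N. \<Sum>b<N. (g ^\<^sub>m k) $$ (a, b) * cnj ((g ^\<^sub>m l) $$ (a, b))) = ptr (k - l) g"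
proof -
  have c: "g \<in> carrier_mat N N" "g ^\<^sub>m l \<in> carrier_mat N N" "g ^\<^sub>m k \<in> carrier_mat N N" "g ^\<^sub>m (k - l) \<in> carrier_mat N N"
    using unitary_group_carrier[OF g] by auto
  have "g ^\<^sub>m k * mat_adjoint (g ^\<^sub>m l) = g ^\<^sub>m (k - l) * g ^\<^sub>m l * mat_adjoint (g ^\<^sub>m l)"
    using pow_mat_add[OF c(1), of "k - l" l] \<open>l \<le> k\<close> by simp
  also have "\<dots> = g ^\<^sub>m (k - l) * (g ^\<^sub>m l * mat_adjoint (g ^\<^sub>m l))"
    by (rule assoc_mult_mat[OF c(4) c(2) mat_adjoint_carrier[OF c(2)]])
  also have "\<dots> = g ^\<^sub>m (k - l)"
    using pow_in_unitary_group[OF g, of l] c by (simp add: unitary_group_def)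
  finally have eq: "g ^\<^sub>m k * mat_adjoint (g ^\<^sub>m l) = g ^\<^sub>m (k - l)" .
  have "(\<Sum>b<N. (g ^\<^sub>m k) $$ (a, b) * cnj ((g ^\<^sub>m l) $$ (a, b))) = (g ^\<^sub>m (k - l)) $$ (a, a)" if "a < N" for a
    unfolding eq[symmetric] mult_mat_entry[OF c(3) mat_adjoint_carrier[OF c(2)] that that]
    using that by (intro sum.cong) (auto simp: mat_adjoint_entry[OF c(2)])
  then show ?thesis by (simp add: ptr_def)
qed

definition pmoment :: "nat multiset \<Rightarrow> nat multiset \<Rightarrow> complex" where
  "pmoment \<rho> \<nu> = (\<integral>g. ptrs \<rho> g * cnj (ptrs \<nu> g) \<partial>\<mu>)"

lemma integral_sum_mset:
  assumes "\<And>x. x \<in># A \<Longrightarrow> bdd_meas (f x)"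
  shows "(\<integral>g. (\<Sum>x\<in>#A. f x g) \<partial>\<mu>) = (\<Sum>x\<in>#A. (\<integral>g. f x g \<partial>\<mu>))"
  using assms
proof (induction A)
  case (add x A)
  have "bdd_meas (f x)" "bdd_meas (\<lambda>g. \<Sum>x\<in>#A. f x g)" using add.prems by auto
  then have "(\<integral>g. f x g + (\<Sum>x\<in>#A. f x g) \<partial>\<mu>) = (\<integral>g. f x g \<partial>\<mu>) + (\<integral>g. (\<Sum>x\<in>#A. f x g) \<partial>\<mu>)"
    by (intro Bochner_Integration.integral_add bdd_meas_integrable)
  then show ?case using add by simp
qed simp

lemma integral_sum':
  assumes "\<And>x. x \<in> A \<Longrightarrow> bdd_meas (f x)"
  shows "(\<integral>g. (\<Sum>x\<in>A. f x g) \<partial>\<mu>) = (\<Sum>x\<in>A. (\<integral>g. f x g \<partial>\<mu>))"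
  using assms by (intro Bochner_Integration.integral_sum bdd_meas_integrable) auto

end

section \<open>Moments of traces\<close>

context haar_unitary
begin

text \<open>Differentiate entry (a, b) of the i-th power of g, times \<open>ptrs \<rho>\<close> and
  the conjugate of \<open>ptrs \<nu>\<close>, in the direction of the matrix unit at (a, b).
  \<open>A\<close>, \<open>B\<close> and \<open>C\<close> come from the three factors. Their sums
  over a and b are the traces \<open>T1\<close>, \<open>T2\<close> and \<open>T3\<close>, and the
  integral of the total is 0.\<close>

lemma loop_equation_pmoment:
  assumes i: "i > 0"
  shows "loop_equation N pmoment i \<rho> \<nu>"
proof -
  define Q where "Q g = ptrs \<rho> g" for g
  define R where "R g = cnj (ptrs \<nu> g)" for g
  define A where "A a b g = (\<Sum>j<i. (g ^\<^sub>m j) $$ (a, a) * (g ^\<^sub>m (i - j)) $$ (b, b)) * (Q g * R g)" for a b g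
  define B where "B a b g = (g ^\<^sub>m i) $$ (a, b) * ((\<Sum>l\<in>#\<rho>. of_nat l * (g ^\<^sub>m l) $$ (b, a) * ptrs (\<rho> - {#l#}) g) * R g)" for a b g
  define C where "C a b g = (g ^\<^sub>m i) $$ (a, b) * (Q g * cnj (\<Sum>l\<in>#\<nu>. of_nat l * (g ^\<^sub>m l) $$ (a, b) * ptrs (\<nu> - {#l#}) g))" for a b g
  \<comment> \<open>The trace of the i-th power times the adjoint of the l-th power, in whichever
    form has a nonnegative exponent.\<close>
  define X where "X l g = (if l \<le> i then ptr (i - l) g else cnj (ptr (l - i) g))" for l g
  define T1 where "T1 g = (\<Sum>j<i. ptr j g * ptr (i - j) g * (Q g * R g))" for g
  define T2 where "T2 g = (\<Sum>l\<in>#\<rho>. of_nat l * (ptr (i + l) g * ptrs (\<rho> - {#l#}) g * R g))" for g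
  define T3 where "T3 g = (\<Sum>l\<in>#\<nu>. of_nat l * (X l g * Q g * cnj (ptrs (\<nu> - {#l#}) g)))" for g
  have bQR: "bdd_meas Q" "bdd_meas R" unfolding Q_def R_def by auto
  have bX: "bdd_meas (X l)" for l unfolding X_def by (cases "l \<le> i") auto
  have b: "bdd_meas T1" "bdd_meas T2" "bdd_meas T3"
    unfolding T1_def T2_def T3_def using bQR bX
    by (intro bdd_meas_sum bdd_meas_sum_mset bdd_meas_mult bdd_meas_cnj; auto)+
  have int0: "(\<integral>g. A a b g + B a b g - C a b g \<partial>\<mu>) = 0 \<and> bdd_meas (\<lambda>g. A a b g + B a b g - C a b g)" if ab: "a < N" "b < N" for a b
  proof -
    have "left_deriv (\<lambda>g. (g ^\<^sub>m i) $$ (a, b) * (ptrs \<rho> g * cnj (ptrs \<nu> g)))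
      (\<lambda>c d g. (g ^\<^sub>m i) $$ (a, b) * (ptrs \<rho> g * (- cnj (\<Sum>l\<in>#\<nu>. of_nat l * (g ^\<^sub>m l) $$ (c, d) * ptrs (\<nu> - {#l#}) g))
           + (\<Sum>l\<in>#\<rho>. of_nat l * (g ^\<^sub>m l) $$ (d, c) * ptrs (\<rho> - {#l#}) g) * cnj (ptrs \<nu> g))
         + (\<Sum>j<i. (g ^\<^sub>m j) $$ (a, c) * (g ^\<^sub>m (i - j)) $$ (d, b)) * (ptrs \<rho> g * cnj (ptrs \<nu> g)))"
      by (intro left_deriv_mult left_deriv_pow_entry ab left_deriv_ptrs left_deriv_cnj[OF left_deriv_ptrs])
    from left_deriv_integral[OF this ab] left_derivD(2)[OF this ab]
    show ?thesis unfolding A_def B_def C_def Q_def R_def by (simp add: algebra_simps)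
  qed
  have pointwise: "(\<Sum>a<N. \<Sum>b<N. A a b g + B a b g - C a b g) = T1 g + T2 g - T3 g" if g: "g \<in> unitary_group N" for g
  proof -
    have "(\<Sum>a<N. \<Sum>b<N. A a b g) = T1 g"
    proof -
      have "(\<Sum>a<N. \<Sum>b<N. A a b g) = (\<Sum>a<N. \<Sum>b<N. \<Sum>j<i. (g ^\<^sub>m j) $$ (a, a) * (g ^\<^sub>m (i - j)) $$ (b, b) * (Q g * R g))"
        unfolding A_def sum_distrib_right ..
      also have "\<dots> = (\<Sum>a<N. \<Sum>j<i. \<Sum>b<N. (g ^\<^sub>m j) $$ (a, a) * (g ^\<^sub>m (i - j)) $$ (b, b) * (Q g * R g))"
        by (intro sum.cong refl sum.swap)
      also have "\<dots> = (\<Sum>j<i. \<Sum>a<N. \<Sum>b<N. (g ^\<^sub>m j) $$ (a, a) * (g ^\<^sub>m (i - j)) $$ (b, b) * (Q g * R g))"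
        by (rule sum.swap)
      also have "\<dots> = T1 g" unfolding T1_def ptr_def sum_product by (simp add: sum_distrib_right)
      finally show ?thesis .
    qed
    moreover have "(\<Sum>a<N. \<Sum>b<N. B a b g) = T2 g"
    proof -
      have "(\<Sum>a<N. \<Sum>b<N. B a b g) = (\<Sum>a<N. \<Sum>b<N. \<Sum>l\<in>#\<rho>. of_nat l * ((g ^\<^sub>m i) $$ (a, b) * (g ^\<^sub>m l) $$ (b, a) * ptrs (\<rho> - {#l#}) g * R g))"
        unfolding B_def sum_mset_distrib_left sum_mset_distrib_right multiset.map_comp o_def by (simp add: algebra_simps)
      also have "\<dots> = (\<Sum>l\<in>#\<rho>. \<Sum>a<N. \<Sum>b<N. of_nat l * ((g ^\<^sub>m i) $$ (a, b) * (g ^\<^sub>m l) $$ (b, a) * ptrs (\<rho> - {#l#}) g * R g))"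
        unfolding sum_sum_mset_swap ..
      also have "\<dots> = T2 g" unfolding T2_def
      proof (intro arg_cong[where f = sum_mset] image_mset_cong)
        fix l
        have "(\<Sum>a<N. \<Sum>b<N. (g ^\<^sub>m i) $$ (a, b) * (g ^\<^sub>m l) $$ (b, a)) = ptr (i + l) g"
          unfolding ptr_def using pow_mult_entry[OF g] by (intro sum.cong) auto
        then show "(\<Sum>a<N. \<Sum>b<N. of_nat l * ((g ^\<^sub>m i) $$ (a, b) * (g ^\<^sub>m l) $$ (b, a) * ptrs (\<rho> - {#l#}) g * R g))
           = of_nat l * (ptr (i + l) g * ptrs (\<rho> - {#l#}) g * R g)"
          by (simp add: sum_distrib_left[symmetric] sum_distrib_right[symmetric])
      qed
      finally show ?thesis .
    qed
    moreover have "(\<Sum>a<N. \<Sum>b<N. C a b g) = T3 g"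
    proof -
      have cnj_mset: "cnj (\<Sum>l\<in>#S. f l) = (\<Sum>l\<in>#S. cnj (f l))" for S and f :: "nat \<Rightarrow> complex"
        by (induction S) auto
      have "(\<Sum>a<N. \<Sum>b<N. C a b g) = (\<Sum>a<N. \<Sum>b<N. \<Sum>l\<in>#\<nu>. of_nat l * ((g ^\<^sub>m i) $$ (a, b) * cnj ((g ^\<^sub>m l) $$ (a, b)) * Q g * cnj (ptrs (\<nu> - {#l#}) g)))"
        unfolding C_def cnj_mset sum_mset_distrib_left sum_mset_distrib_right multiset.map_comp o_def by (simp add: algebra_simps)
      also have "\<dots> = (\<Sum>l\<in>#\<nu>. \<Sum>a<N. \<Sum>b<N. of_nat l * ((g ^\<^sub>m i) $$ (a, b) * cnj ((g ^\<^sub>m l) $$ (a, b)) * Q g * cnj (ptrs (\<nu> - {#l#}) g)))"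
        unfolding sum_sum_mset_swap ..
      also have "\<dots> = T3 g" unfolding T3_def
      proof (intro arg_cong[where f = sum_mset] image_mset_cong)
        fix l
        have "(\<Sum>a<N. \<Sum>b<N. (g ^\<^sub>m i) $$ (a, b) * cnj ((g ^\<^sub>m l) $$ (a, b))) = X l g"
        proof (cases "l \<le> i")
          case True
          then show ?thesis using sum_pow_cnj_pow[OF g True] by (simp add: X_def)
        next
          case False
          then have "cnj (\<Sum>a<N. \<Sum>b<N. (g ^\<^sub>m l) $$ (a, b) * cnj ((g ^\<^sub>m i) $$ (a, b))) = X l g"
            using sum_pow_cnj_pow[OF g, of i l] by (simp add: X_def)
          then show ?thesis by (simp add: mult.commute)
        qed
        then show "(\<Sum>a<N. \<Sum>b<N. of_nat l * ((g ^\<^sub>m i) $$ (a, b) * cnj ((g ^\<^sub>m l) $$ (a, b)) * Q g * cnj (ptrs (\<nu> - {#l#}) g)))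
           = of_nat l * (X l g * Q g * cnj (ptrs (\<nu> - {#l#}) g))"
          by (simp add: sum_distrib_left[symmetric] sum_distrib_right[symmetric])
      qed
      finally show ?thesis .
    qed
    ultimately show ?thesis by (simp add: sum.distrib sum_subtractf)
  qed
  have "0 = (\<Sum>a<N. \<Sum>b<N. (\<integral>g. A a b g + B a b g - C a b g \<partial>\<mu>))" using int0 by simp
  also have "\<dots> = (\<Sum>a<N. (\<integral>g. (\<Sum>b<N. A a b g + B a b g - C a b g) \<partial>\<mu>))"
    using int0 by (intro sum.cong refl integral_sum'[symmetric]) auto
  also have "\<dots> = (\<integral>g. (\<Sum>a<N. \<Sum>b<N. A a b g + B a b g - C a b g) \<partial>\<mu>)"
    using int0 by (intro integral_sum'[symmetric] bdd_meas_sum) auto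
  also have "\<dots> = (\<integral>g. T1 g + T2 g - T3 g \<partial>\<mu>)"
    using pointwise by (intro Bochner_Integration.integral_cong) auto
  also have "\<dots> = (\<integral>g. T1 g \<partial>\<mu>) + (\<integral>g. T2 g \<partial>\<mu>) - (\<integral>g. T3 g \<partial>\<mu>)"
    using b by (simp add: bdd_meas_integrable)
  finally have main: "(\<integral>g. T1 g \<partial>\<mu>) + (\<integral>g. T2 g \<partial>\<mu>) = (\<integral>g. T3 g \<partial>\<mu>)" by simp
  have "(\<integral>g. T1 g \<partial>\<mu>) = (\<Sum>j<i. (\<integral>g. ptr j g * ptr (i - j) g * (Q g * R g) \<partial>\<mu>))"
    unfolding T1_def using bQR by (intro integral_sum' bdd_meas_mult bdd_meas_ptr)
  also have "\<dots> = of_nat N * pmoment (add_mset i \<rho>) \<nu> + (\<Sum>j\<in>{1..<i}. pmoment (add_mset j (add_mset (i - j) \<rho>)) \<nu>)"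
  proof -
    \<comment> \<open>The cut at j = 0 gives the trace of the identity, which supplies the dominant
      coefficient N.\<close>
    have "{..<i} = insert 0 {1..<i}" using i by auto
    then have "(\<Sum>j<i. (\<integral>g. ptr j g * ptr (i - j) g * (Q g * R g) \<partial>\<mu>))
       = (\<integral>g. ptr 0 g * ptr i g * (Q g * R g) \<partial>\<mu>) + (\<Sum>j\<in>{1..<i}. (\<integral>g. ptr j g * ptr (i - j) g * (Q g * R g) \<partial>\<mu>))"
      by simp
    also have "(\<integral>g. ptr 0 g * ptr i g * (Q g * R g) \<partial>\<mu>) = (\<integral>g. of_nat N * (ptr i g * (Q g * R g)) \<partial>\<mu>)"
      using ptr_0 by (intro Bochner_Integration.integral_cong) auto
    also have "\<dots> = of_nat N * pmoment (add_mset i \<rho>) \<nu>"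
      by (simp add: pmoment_def Q_def R_def mult.assoc)
    finally show ?thesis by (simp add: pmoment_def Q_def R_def mult.assoc)
  qed
  finally have 1: "(\<integral>g. T1 g \<partial>\<mu>) = \<dots>" .
  have 2: "(\<integral>g. T2 g \<partial>\<mu>) = (\<Sum>l\<in>#\<rho>. of_nat l * pmoment (add_mset (i + l) (\<rho> - {#l#})) \<nu>)"
    unfolding T2_def using bQR
    by (subst integral_sum_mset) (auto simp: pmoment_def R_def intro!: bdd_meas_mult)
  have 3: "(\<integral>g. T3 g \<partial>\<mu>) = (\<Sum>l\<in>#\<nu>. of_nat l *
          (if l = i then of_nat N * pmoment \<rho> (\<nu> - {#l#})
           else if l < i then pmoment (add_mset (i - l) \<rho>) (\<nu> - {#l#})
           else pmoment \<rho> (add_mset (l - i) (\<nu> - {#l#}))))"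
  proof -
    have "(\<integral>g. T3 g \<partial>\<mu>) = (\<Sum>l\<in>#\<nu>. (\<integral>g. of_nat l * (X l g * Q g * cnj (ptrs (\<nu> - {#l#}) g)) \<partial>\<mu>))"
      unfolding T3_def using bQR bX by (intro integral_sum_mset) (auto intro!: bdd_meas_mult)
    also have "\<dots> = (\<Sum>l\<in>#\<nu>. of_nat l *
          (if l = i then of_nat N * pmoment \<rho> (\<nu> - {#l#})
           else if l < i then pmoment (add_mset (i - l) \<rho>) (\<nu> - {#l#})
           else pmoment \<rho> (add_mset (l - i) (\<nu> - {#l#}))))"
    proof (intro arg_cong[where f = sum_mset] image_mset_cong)
      fix l
      consider "l = i" | "l < i" | "l > i" by linarith
      then have "(\<integral>g. X l g * Q g * cnj (ptrs (\<nu> - {#l#}) g) \<partial>\<mu>) =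
          (if l = i then of_nat N * pmoment \<rho> (\<nu> - {#l#})
           else if l < i then pmoment (add_mset (i - l) \<rho>) (\<nu> - {#l#})
           else pmoment \<rho> (add_mset (l - i) (\<nu> - {#l#})))"
      proof cases
        case 1
        have "(\<integral>g. X l g * Q g * cnj (ptrs (\<nu> - {#l#}) g) \<partial>\<mu>) = (\<integral>g. of_nat N * (Q g * cnj (ptrs (\<nu> - {#l#}) g)) \<partial>\<mu>)"
          using 1 ptr_0 by (intro Bochner_Integration.integral_cong) (auto simp: X_def)
        then show ?thesis using 1 by (simp add: pmoment_def Q_def)
      qed (simp_all add: X_def pmoment_def Q_def mult_ac)
      then show "(\<integral>g. of_nat l * (X l g * Q g * cnj (ptrs (\<nu> - {#l#}) g)) \<partial>\<mu>) = of_nat l *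
          (if l = i then of_nat N * pmoment \<rho> (\<nu> - {#l#})
           else if l < i then pmoment (add_mset (i - l) \<rho>) (\<nu> - {#l#})
           else pmoment \<rho> (add_mset (l - i) (\<nu> - {#l#})))" by simp
    qed
    finally show ?thesis .
  qed
  show ?thesis unfolding loop_equation_def using main unfolding 1 2 3 .
qed

lemma ptr_scalar_mult:
  assumes g: "g \<in> unitary_group N"
  shows "ptr k (z \<cdot>\<^sub>m 1\<^sub>m N * g) = z ^ k * ptr k g"
proof -
  have c: "g \<in> carrier_mat N N" using g by (rule unitary_group_carrier)
  have 1: "z \<cdot>\<^sub>m 1\<^sub>m N * g = z \<cdot>\<^sub>m g" using c by (simp add: mult_smult_assoc_mat[of _ N N _ N])
  have "(z \<cdot>\<^sub>m g) ^\<^sub>m k = z ^ k \<cdot>\<^sub>m g ^\<^sub>m k"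
  proof (induction k)
    case 0
    show ?case by (intro eq_matI) (use c in auto)
  next
    case (Suc k)
    have ck: "g ^\<^sub>m k \<in> carrier_mat N N" using c by simp
    have "(z \<cdot>\<^sub>m g) ^\<^sub>m Suc k = (z ^ k \<cdot>\<^sub>m g ^\<^sub>m k) * (z \<cdot>\<^sub>m g)" using Suc by simp
    also have "\<dots> = z ^ k \<cdot>\<^sub>m (z \<cdot>\<^sub>m (g ^\<^sub>m k * g))"
      using mult_smult_assoc_mat[OF ck, of "z \<cdot>\<^sub>m g" N "z ^ k"] mult_smult_distrib[OF ck c] c by simp
    also have "\<dots> = z ^ Suc k \<cdot>\<^sub>m g ^\<^sub>m Suc k"
      by (intro eq_matI) auto
    finally show ?case .
  qed
  then show ?thesis unfolding 1 ptr_def using c by (simp add: sum_distrib_left)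
qed

text \<open>Multiplication by the scalar exp (i pi / n), with n the weight of \<nu>, changes the
  sign of \<open>ptrs \<nu>\<close> and preserves the measure.\<close>

lemma pmoment_empty:
  assumes "0 \<notin># \<nu>"
  shows "pmoment {#} \<nu> = wick {#} \<nu>"
proof (cases "\<nu> = {#}")
  case True
  then show ?thesis by (simp add: pmoment_def wick_def)
next
  case False
  define n where "n = sum_mset \<nu>"
  have "n > 0" using False assms unfolding n_def by (cases \<nu>) auto
  define z where "z = cis (pi / real n)"
  have zn: "z ^ n = -1" using \<open>n > 0\<close> by (simp add: z_def Complex.DeMoivre)
  define h where "h = z \<cdot>\<^sub>m (1\<^sub>m N :: complex mat)"
  have hc: "h \<in> carrier_mat N N" by (simp add: h_def)
  have adj: "mat_adjoint h = cnj z \<cdot>\<^sub>m 1\<^sub>m N"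
    using hc by (intro eq_matI) (auto simp: mat_adjoint_entry[OF hc], auto simp: h_def)
  have zz: "cnj z * z = 1" "z * cnj z = 1" by (auto simp: z_def cis_cnj cis_mult)
  have "mat_adjoint h * h = 1\<^sub>m N" "h * mat_adjoint h = 1\<^sub>m N"
    unfolding adj unfolding h_def using zz
    by (auto simp: mult_smult_assoc_mat[of _ N N _ N] intro!: eq_matI)
  then have h: "h \<in> unitary_group N" using hc by (simp add: unitary_group_def)
  have "ptrs \<nu> (h * g) = z ^ sum_mset \<nu> * ptrs \<nu> g" if "g \<in> unitary_group N" for g
    using ptr_scalar_mult[OF that, of _ z] unfolding h_def[symmetric]
    by (induction \<nu>) (auto simp: power_add)
  then have eq: "ptrs \<nu> (h * g) = - ptrs \<nu> g" if "g \<in> unitary_group N" for g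
    using that zn by (simp add: n_def)
  have "pmoment {#} \<nu> = (\<integral>g. cnj (ptrs \<nu> (h * g)) \<partial>\<mu>)"
    using integral_mult[OF h, of "\<lambda>g. cnj (ptrs \<nu> g)"] bdd_meas_cnj[OF bdd_meas_ptrs[of \<nu>]]
    by (simp add: pmoment_def bdd_meas_def)
  also have "\<dots> = (\<integral>g. - cnj (ptrs \<nu> g) \<partial>\<mu>)"
    using eq by (intro Bochner_Integration.integral_cong) auto
  also have "\<dots> = - pmoment {#} \<nu>" by (simp add: pmoment_def)
  finally have "pmoment {#} \<nu> = 0" by simp
  then show ?thesis using False by (simp add: wick_empty_left)
qed

lemma norm_pmoment_le: "norm (pmoment \<rho> \<nu>) \<le> real N ^ size \<rho> * real N ^ size \<nu>"
proof -
  have "norm (pmoment \<rho> \<nu>) \<le> (\<integral>g. norm (ptrs \<rho> g * cnj (ptrs \<nu> g)) \<partial>\<mu>)"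
    unfolding pmoment_def by (rule integral_norm_bound)
  also have "\<dots> \<le> (\<integral>g. real N ^ size \<rho> * real N ^ size \<nu> \<partial>\<mu>)"
    by (intro integral_mono integrable_norm bdd_meas_integrable bdd_meas_mult bdd_meas_cnj bdd_meas_ptrs)
       (auto simp: norm_mult intro!: mult_mono norm_ptrs_le)
  finally show ?thesis by simp
qed

lemma pmoment_eq_wick:
  assumes "0 \<notin># \<rho>" "0 \<notin># \<nu>" "sum_mset \<rho> \<le> N"
  shows "pmoment \<rho> \<nu> = wick \<rho> \<nu>"
proof (rule loop_equation_unique[where M = pmoment and N = N])
  show "loop_equation N pmoment i \<rho> \<nu>" if "i > 0" for i \<rho> \<nu> by (rule loop_equation_pmoment[OF that])
  fix n and \<nu> :: "nat multiset"
  have "norm (pmoment \<rho> \<nu>) \<le> max 1 (real N) ^ n * real N ^ size \<nu>" if "0 \<notin># \<rho>" "sum_mset \<rho> = n" for \<rho>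
  proof -
    \<comment> \<open>Without zero parts the size is at most the weight. The maximum with 1 keeps
      the powers monotone for N = 0 too.\<close>
    have "size \<rho> \<le> sum_mset \<rho>" using that(1) by (induction \<rho>) auto
    then have "real N ^ size \<rho> \<le> max 1 (real N) ^ n"
      using that by (intro order_trans[OF power_mono power_increasing, of "real N" "max 1 (real N)"]) auto
    then show ?thesis
      using norm_pmoment_le[of \<rho> \<nu>] mult_right_mono[of "real N ^ size \<rho>" "max 1 (real N) ^ n" "real N ^ size \<nu>"] by simp
  qed
  then show "\<exists>B. \<forall>\<rho>. 0 \<notin># \<rho> \<longrightarrow> sum_mset \<rho> = n \<longrightarrow> norm (pmoment \<rho> \<nu>) \<le> B" by auto
qed (use assms pmoment_empty in auto)

end

section \<open>Linear combinations of power sums and their even moments\<close>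

context haar_unitary
begin

definition ptr_comb :: "(nat \<Rightarrow> complex) \<Rightarrow> nat \<Rightarrow> complex mat \<Rightarrow> complex" where
  "ptr_comb a L g = (\<Sum>k\<in>{1..L}. a k * ptr k g)"

lemma bdd_meas_ptr_comb [intro]: "bdd_meas (ptr_comb a L)"
  unfolding ptr_comb_def[abs_def] by (intro bdd_meas_sum bdd_meas_mult bdd_meas_ptr bdd_meas_const)

text \<open>The m + q factors of the combination stay unexpanded beside power sums already singled
  out. Powers can thus be opened one factor at a time, without a multinomial expansion.\<close>

definition comb_moment :: "(nat \<Rightarrow> complex) \<Rightarrow> nat \<Rightarrow> nat \<Rightarrow> nat \<Rightarrow> nat multiset \<Rightarrow> nat multiset \<Rightarrow> complex" where
  "comb_moment a L q m \<rho> \<nu> = (\<integral>g. ptr_comb a L g ^ m * cnj (ptr_comb a L g) ^ q * (ptrs \<rho> g * cnj (ptrs \<nu> g)) \<partial>\<mu>)"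

lemma comb_moment_Suc_left:
  "comb_moment a L q (Suc m) \<rho> \<nu> = (\<Sum>k\<in>{1..L}. a k * comb_moment a L q m (add_mset k \<rho>) \<nu>)"
proof -
  have "comb_moment a L q (Suc m) \<rho> \<nu> = (\<integral>g. (\<Sum>k\<in>{1..L}. a k *
      (ptr_comb a L g ^ m * cnj (ptr_comb a L g) ^ q * (ptrs (add_mset k \<rho>) g * cnj (ptrs \<nu> g)))) \<partial>\<mu>)"
    unfolding comb_moment_def
  proof (rule Bochner_Integration.integral_cong[OF refl])
    fix g
    have eq: "ptr_comb a L g ^ Suc m * cnj (ptr_comb a L g) ^ q * (ptrs \<rho> g * cnj (ptrs \<nu> g))
      = (\<Sum>k\<in>{1..L}. a k * ptr k g) * (ptr_comb a L g ^ m * cnj (ptr_comb a L g) ^ q * (ptrs \<rho> g * cnj (ptrs \<nu> g)))"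
      unfolding ptr_comb_def[of a L g, symmetric] by (simp add: mult_ac)
    show "ptr_comb a L g ^ Suc m * cnj (ptr_comb a L g) ^ q * (ptrs \<rho> g * cnj (ptrs \<nu> g))
      = (\<Sum>k\<in>{1..L}. a k * (ptr_comb a L g ^ m * cnj (ptr_comb a L g) ^ q * (ptrs (add_mset k \<rho>) g * cnj (ptrs \<nu> g))))"
      unfolding eq sum_distrib_right by (intro sum.cong refl) (simp add: mult_ac)
  qed
  also have "\<dots> = (\<Sum>k\<in>{1..L}. (\<integral>g. a k * (ptr_comb a L g ^ m * cnj (ptr_comb a L g) ^ q * (ptrs (add_mset k \<rho>) g * cnj (ptrs \<nu> g))) \<partial>\<mu>))"
    by (intro integral_sum' bdd_meas_mult bdd_meas_const bdd_meas_power bdd_meas_cnj bdd_meas_ptr_comb bdd_meas_ptrs)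
  finally show ?thesis by (simp add: comb_moment_def)
qed

lemma comb_moment_Suc_right:
  "comb_moment a L (Suc q) m \<rho> \<nu> = (\<Sum>k\<in>{1..L}. cnj (a k) * comb_moment a L q m \<rho> (add_mset k \<nu>))"
proof -
  have "comb_moment a L (Suc q) m \<rho> \<nu> = (\<integral>g. (\<Sum>k\<in>{1..L}. cnj (a k) *
      (ptr_comb a L g ^ m * cnj (ptr_comb a L g) ^ q * (ptrs \<rho> g * cnj (ptrs (add_mset k \<nu>) g)))) \<partial>\<mu>)"
    unfolding comb_moment_def
  proof (rule Bochner_Integration.integral_cong[OF refl])
    fix g
    have eq: "ptr_comb a L g ^ m * cnj (ptr_comb a L g) ^ Suc q * (ptrs \<rho> g * cnj (ptrs \<nu> g))
      = (\<Sum>k\<in>{1..L}. cnj (a k) * cnj (ptr k g)) * (ptr_comb a L g ^ m * cnj (ptr_comb a L g) ^ q * (ptrs \<rho> g * cnj (ptrs \<nu> g)))"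
      unfolding complex_cnj_mult[symmetric] cnj_sum[symmetric] ptr_comb_def[of a L g, symmetric] by (simp add: mult_ac)
    show "ptr_comb a L g ^ m * cnj (ptr_comb a L g) ^ Suc q * (ptrs \<rho> g * cnj (ptrs \<nu> g))
      = (\<Sum>k\<in>{1..L}. cnj (a k) * (ptr_comb a L g ^ m * cnj (ptr_comb a L g) ^ q * (ptrs \<rho> g * cnj (ptrs (add_mset k \<nu>) g))))"
      unfolding eq sum_distrib_right by (intro sum.cong refl) (simp add: mult_ac)
  qed
  also have "\<dots> = (\<Sum>k\<in>{1..L}. (\<integral>g. cnj (a k) * (ptr_comb a L g ^ m * cnj (ptr_comb a L g) ^ q * (ptrs \<rho> g * cnj (ptrs (add_mset k \<nu>) g))) \<partial>\<mu>))"
    by (intro integral_sum' bdd_meas_mult bdd_meas_const bdd_meas_power bdd_meas_cnj bdd_meas_ptr_comb bdd_meas_ptrs)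
  finally show ?thesis by (simp add: comb_moment_def)
qed

lemma comb_moment_0: "comb_moment a L 0 0 \<rho> \<nu> = pmoment \<rho> \<nu>"
  by (simp add: comb_moment_def pmoment_def)

text \<open>
  Contracting one antiholomorphic factor, as in Wick's formula: its partner is either one of the
  \<^term>\<open>m\<close> linear combinations or one of the power sums in \<^term>\<open>\<rho>\<close>.
\<close>
lemma comb_moment_contract:
  assumes "0 \<notin># \<rho>" "0 \<notin># \<nu>" "j \<in> {1..L}" "sum_mset \<rho> + m * L \<le> N"
  shows "comb_moment a L 0 m \<rho> (add_mset j \<nu>) =
     of_nat (m * j) * a j * comb_moment a L 0 (m - 1) \<rho> \<nu>
     + of_nat (j * count \<rho> j) * comb_moment a L 0 m (\<rho> - {#j#}) \<nu>"
  using assms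
proof (induction m arbitrary: \<rho>)
  case 0
  have "sum_mset (\<rho> - {#j#}) \<le> sum_mset \<rho>" by (cases "j \<in># \<rho>") (auto simp: sum_mset_diff)
  then have "pmoment (\<rho> - {#j#}) \<nu> = wick (\<rho> - {#j#}) \<nu>"
    using 0 by (intro pmoment_eq_wick) (auto dest: in_diffD)
  moreover have "pmoment \<rho> (add_mset j \<nu>) = wick \<rho> (add_mset j \<nu>)"
    using 0 by (intro pmoment_eq_wick) auto
  ultimately show ?case
    using wick_add_mset_left[of j \<nu> \<rho>] by (simp add: comb_moment_0 wick_commute[of \<rho>] wick_commute[of "\<rho> - {#j#}"])
next
  case (Suc m)
  have IH: "comb_moment a L 0 m (add_mset k \<rho>) (add_mset j \<nu>) =
     of_nat (m * j) * a j * comb_moment a L 0 (m - 1) (add_mset k \<rho>) \<nu>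
     + of_nat (j * count (add_mset k \<rho>) j) * comb_moment a L 0 m (add_mset k \<rho> - {#j#}) \<nu>" if "k \<in> {1..L}" for k
    using Suc.prems that by (intro Suc.IH) auto
  \<comment> \<open>For m = 0 the truncated \<open>m - 1\<close> is harmless, since both sides carry
    a factor 0.\<close>
  have m1: "of_nat (m * j) * a j * (\<Sum>k\<in>{1..L}. a k * comb_moment a L 0 (m - 1) (add_mset k \<rho>) \<nu>)
      = of_nat (m * j) * a j * comb_moment a L 0 m \<rho> \<nu>"
    by (cases m) (simp_all add: comb_moment_Suc_left)
  \<comment> \<open>The factor k just opened is itself a possible partner of j. Separating it gives
    the extra term that raises m to \<open>Suc m\<close>.\<close>
  have c: "of_nat (j * count (add_mset k \<rho>) j) * comb_moment a L 0 m (add_mset k \<rho> - {#j#}) \<nu>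
     = (if k = j then of_nat j * comb_moment a L 0 m \<rho> \<nu> else 0)
       + of_nat (j * count \<rho> j) * comb_moment a L 0 m (add_mset k (\<rho> - {#j#})) \<nu>" for k
  proof (cases "j \<in># \<rho>")
    case True
    then show ?thesis by (auto simp: algebra_simps dest!: multi_member_split)
  next
    case False
    then show ?thesis by (auto simp: not_in_iff)
  qed
  have "comb_moment a L 0 (Suc m) \<rho> (add_mset j \<nu>) =
      (\<Sum>k\<in>{1..L}. a k * (of_nat (m * j) * a j * comb_moment a L 0 (m - 1) (add_mset k \<rho>) \<nu>
     + ((if k = j then of_nat j * comb_moment a L 0 m \<rho> \<nu> else 0)
       + of_nat (j * count \<rho> j) * comb_moment a L 0 m (add_mset k (\<rho> - {#j#})) \<nu>)))"
    unfolding comb_moment_Suc_left using IH c by (intro sum.cong) auto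
  also have "\<dots> = of_nat (m * j) * a j * (\<Sum>k\<in>{1..L}. a k * comb_moment a L 0 (m - 1) (add_mset k \<rho>) \<nu>)
     + (\<Sum>k\<in>{1..L}. if k = j then a k * (of_nat j * comb_moment a L 0 m \<rho> \<nu>) else 0)
     + of_nat (j * count \<rho> j) * (\<Sum>k\<in>{1..L}. a k * comb_moment a L 0 m (add_mset k (\<rho> - {#j#})) \<nu>)"
    unfolding sum_distrib_left sum.distrib[symmetric] by (intro sum.cong refl) (auto simp: algebra_simps)
  also have "(\<Sum>k\<in>{1..L}. if k = j then a k * (of_nat j * comb_moment a L 0 m \<rho> \<nu>) else 0) = a j * (of_nat j * comb_moment a L 0 m \<rho> \<nu>)"
    using Suc.prems(3) by (subst sum.delta) auto
  finally show ?case unfolding m1 unfolding comb_moment_Suc_left[symmetric] by (simp add: algebra_simps)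
qed

text \<open>The q conjugate factors are spectators: once opened they only join \<nu>, and the
  conjugate factor j pairs with holomorphic factors alone.\<close>

lemma comb_moment_contract':
  assumes "0 \<notin># \<nu>" "j \<in> {1..L}" "m * L \<le> N"
  shows "comb_moment a L q m {#} (add_mset j \<nu>) = of_nat (m * j) * a j * comb_moment a L q (m - 1) {#} \<nu>"
  using assms(1)
proof (induction q arbitrary: \<nu>)
  case 0
  then show ?case using comb_moment_contract[of "{#}" \<nu> j L m a] assms by simp
next
  case (Suc q)
  have "comb_moment a L q m {#} (add_mset k (add_mset j \<nu>)) = of_nat (m * j) * a j * comb_moment a L q (m - 1) {#} (add_mset k \<nu>)"
    if "k \<in> {1..L}" for k
    using Suc.IH[of "add_mset k \<nu>"] Suc.prems that by (simp add: add_mset_commute)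
  then show ?case unfolding comb_moment_Suc_right by (simp add: sum_distrib_left mult_ac)
qed

text \<open>Open one conjugate factor and contract it: each of the \<open>Suc m\<close> holomorphic
  copies is a possible partner and yields the variance, leaving the same moment one order
  lower.\<close>

lemma comb_moment_diag:
  assumes "m * L \<le> N"
  shows "comb_moment a L m m {#} {#} = fact m * (\<Sum>k\<in>{1..L}. of_nat k * (a k * cnj (a k))) ^ m"
  using assms
proof (induction m)
  case 0
  then show ?case by (simp add: comb_moment_def)
next
  case (Suc m)
  have "comb_moment a L (Suc m) (Suc m) {#} {#}
     = (\<Sum>k\<in>{1..L}. cnj (a k) * (of_nat (Suc m * k) * a k * comb_moment a L m m {#} {#}))"
    unfolding comb_moment_Suc_right[of a L m "Suc m"] using Suc.prems
    by (intro sum.cong refl arg_cong2[where f = "(*)"], subst comb_moment_contract') auto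
  also have "\<dots> = of_nat (Suc m) * (\<Sum>k\<in>{1..L}. of_nat k * (a k * cnj (a k))) * comb_moment a L m m {#} {#}"
    unfolding sum_distrib_left sum_distrib_right by (intro sum.cong refl) (simp only: of_nat_mult mult_ac)
  also have "comb_moment a L m m {#} {#} = fact m * (\<Sum>k\<in>{1..L}. of_nat k * (a k * cnj (a k))) ^ m"
    using Suc by simp
  finally show ?case by (simp add: mult_ac del: of_nat_Suc)
qed

lemma ptr_comb_moment:
  assumes "m * L \<le> N"
  shows "(\<integral>g. cmod (ptr_comb a L g) ^ (2 * m) \<partial>\<mu>) = fact m * (\<Sum>k\<in>{1..L}. real k * (cmod (a k))\<^sup>2) ^ m"
proof -
  have "complex_of_real (cmod z ^ (2 * m)) = z ^ m * cnj z ^ m" for z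
    by (metis complex_norm_square of_real_power power_mult power_mult_distrib)
  note pow = this
  have "of_real (\<integral>g. cmod (ptr_comb a L g) ^ (2 * m) \<partial>\<mu>) = (\<integral>g. complex_of_real (cmod (ptr_comb a L g) ^ (2 * m)) \<partial>\<mu>)"
    by (rule integral_complex_of_real[symmetric])
  also have "\<dots> = comb_moment a L m m {#} {#}"
    unfolding comb_moment_def
    by (intro Bochner_Integration.integral_cong refl) (simp only: pow ptrs_simps complex_cnj_one mult_1_right)
  also have "\<dots> = of_real (fact m * (\<Sum>k\<in>{1..L}. real k * (cmod (a k))\<^sup>2) ^ m)"
    unfolding comb_moment_diag[OF assms] complex_norm_square[symmetric] by simp
  finally show ?thesis unfolding of_real_eq_iff .
qed

text \<open>Markov's inequality for the moment of order 2m. Measurability is stated as well because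
  sets of this form will cover the event to be estimated.\<close>

lemma ptr_comb_tail:
  assumes "m * L \<le> N" "s > 0" and V: "(\<Sum>k\<in>{1..L}. real k * (cmod (a k))\<^sup>2) \<le> V"
  shows "{g \<in> unitary_group N. cmod (ptr_comb a L g) \<ge> s} \<in> sets \<mu>" (is "?S \<in> _")
    and "measure \<mu> {g \<in> unitary_group N. cmod (ptr_comb a L g) \<ge> s} \<le> fact m * (V / s\<^sup>2) ^ m"
proof -
  have meas: "ptr_comb a L \<in> borel_measurable \<mu>" and bdd: "bdd_meas (ptr_comb a L)"
    using bdd_meas_ptr_comb[of a L] by (auto simp: bdd_meas_def)
  have "{g \<in> space \<mu>. cmod (ptr_comb a L g) \<ge> s} \<in> sets \<mu>" using meas by measurable
  then show "?S \<in> sets \<mu>" by simp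
  have int: "integrable \<mu> (\<lambda>g. cmod (ptr_comb a L g) ^ (2 * m))"
    using bdd_meas_integrable[OF bdd_meas_power[OF bdd, of "2 * m"], THEN integrable_norm]
    by (simp add: norm_power)
  have big: "{g \<in> space \<mu>. cmod (ptr_comb a L g) ^ (2 * m) \<ge> s ^ (2 * m)} \<in> sets \<mu>"
    using meas by measurable
  have "measure \<mu> ?S \<le> measure \<mu> {g \<in> space \<mu>. cmod (ptr_comb a L g) ^ (2 * m) \<ge> s ^ (2 * m)}"
    using \<open>s > 0\<close> by (intro finite_measure_mono) (use big in \<open>auto intro: power_mono\<close>)
  also have "\<dots> \<le> (\<integral>g. cmod (ptr_comb a L g) ^ (2 * m) \<partial>\<mu>) / s ^ (2 * m)"
    using int \<open>s > 0\<close> by (intro integral_Markov_inequality_measure[where A = "{}"]) auto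
  also have "\<dots> \<le> fact m * V ^ m / s ^ (2 * m)"
    unfolding ptr_comb_moment[OF assms(1)] using V \<open>s > 0\<close>
    by (intro divide_right_mono mult_left_mono power_mono) (auto intro!: sum_nonneg)
  also have "\<dots> = fact m * (V / s\<^sup>2) ^ m"
    by (simp add: power_divide power_mult)
  finally show "measure \<mu> ?S \<le> fact m * (V / s\<^sup>2) ^ m" .
qed

end

section \<open>Eigenvalues and geometric sums\<close>

lemma upper_triangular_pow:
  fixes B :: "'a::comm_ring_1 mat"
  assumes B: "B \<in> carrier_mat n n" and ut: "upper_triangular B"
  shows "upper_triangular (B ^\<^sub>m k) \<and> (\<forall>i<n. (B ^\<^sub>m k) $$ (i, i) = B $$ (i, i) ^ k)"
proof (induction k)
  case 0
  then show ?case using B by auto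
next
  case (Suc k)
  have ck: "B ^\<^sub>m k \<in> carrier_mat n n" using B by simp
  have z: "(B ^\<^sub>m k) $$ (i, j) = 0" "B $$ (i, j) = 0" if "j < i" "i < n" for i j
    using Suc ut that B ck by (auto simp: upper_triangular_def)
  have e: "(B ^\<^sub>m Suc k) $$ (i, j) = (\<Sum>l<n. (B ^\<^sub>m k) $$ (i, l) * B $$ (l, j))" if "i < n" "j < n" for i j
    using mult_mat_entry[OF ck B that] by simp
  have "(B ^\<^sub>m Suc k) $$ (i, j) = 0" if "j < i" "i < n" for i j
  proof -
    have "(B ^\<^sub>m k) $$ (i, l) * B $$ (l, j) = 0" if "l < n" for l
      using z[of l i] z[of j l] \<open>j < i\<close> \<open>i < n\<close> that by (cases "l < i") auto
    then show ?thesis using that by (subst e) auto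
  qed
  moreover have "(B ^\<^sub>m Suc k) $$ (i, i) = B $$ (i, i) ^ Suc k" if "i < n" for i
  proof -
    have "(B ^\<^sub>m Suc k) $$ (i, i) = (\<Sum>l<n. if l = i then (B ^\<^sub>m k) $$ (i, i) * B $$ (i, i) else 0)"
      unfolding e[OF that that] using z that by (intro sum.cong refl) (auto simp: neq_iff)
    then show ?thesis using that Suc by (simp add: mult.commute)
  qed
  ultimately show ?case using B by (auto simp: upper_triangular_def simp del: pow_mat.simps)
qed

lemma trace_similar_mat_wit:
  fixes A :: "'a::comm_ring_1 mat"
  assumes A: "A \<in> carrier_mat n n" and wit: "similar_mat_wit A B P Q"
  shows "(\<Sum>i<n. A $$ (i, i)) = (\<Sum>i<n. B $$ (i, i))"
proof -
  note w = similar_mat_witD2[OF A wit]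
  have BQ: "B * Q \<in> carrier_mat n n" using w by simp
  have "A = P * (B * Q)" using w(3) assoc_mult_mat[OF w(6) w(5) w(7)] by simp
  then have "(\<Sum>i<n. A $$ (i, i)) = (\<Sum>i<n. \<Sum>k<n. P $$ (i, k) * (B * Q) $$ (k, i))"
    using mult_mat_entry[OF w(6) BQ] by simp
  also have "\<dots> = (\<Sum>k<n. \<Sum>i<n. (B * Q) $$ (k, i) * P $$ (i, k))"
    by (subst sum.swap) (simp add: mult.commute)
  also have "\<dots> = (\<Sum>k<n. ((B * Q) * P) $$ (k, k))"
    using mult_mat_entry[OF BQ w(6)] by simp
  also have "(B * Q) * P = B" using assoc_mult_mat[OF w(5) w(7) w(6)] w by simp
  finally show ?thesis .
qed

text \<open>A unitary matrix preserves the norm of an eigenvector; in entries, the orthonormal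
  columns (\<open>orth\<close>) collapse the triple sum.\<close>

lemma unitary_eigenvalue_norm:
  assumes g: "g \<in> unitary_group N" and ev: "eigenvalue g k"
  shows "cmod k = 1"
proof -
  have c: "g \<in> carrier_mat N N" using g by (rule unitary_group_carrier)
  obtain v where v: "v \<in> carrier_vec N" "v \<noteq> 0\<^sub>v N" "g *\<^sub>v v = k \<cdot>\<^sub>v v"
    using ev c by (auto simp: eigenvalue_def eigenvector_def)
  have row: "(\<Sum>j<N. g $$ (i, j) * v $ j) = k * v $ i" if "i < N" for i
  proof -
    have "(g *\<^sub>v v) $ i = (\<Sum>j<N. g $$ (i, j) * v $ j)"
      using that c v(1) by (auto simp: scalar_prod_def atLeast0LessThan intro!: sum.cong)
    then show ?thesis using v that by simp
  qed
  have orth: "(\<Sum>i<N. g $$ (i, j) * cnj (g $$ (i, l))) = (if j = l then 1 else 0)" if "j < N" "l < N" for j l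
  proof -
    have "(mat_adjoint g * g) $$ (l, j) = (\<Sum>i<N. cnj (g $$ (i, l)) * g $$ (i, j))"
      using that by (simp add: mult_mat_entry[OF mat_adjoint_carrier[OF c] c] mat_adjoint_entry[OF c])
    moreover have "mat_adjoint g * g = 1\<^sub>m N" using g by (simp add: unitary_group_def)
    ultimately show ?thesis using that by (cases "j = l") (simp_all add: mult.commute)
  qed
  let ?S = "\<Sum>i<N. v $ i * cnj (v $ i)"
  have "(k * cnj k) * ?S = (\<Sum>i<N. (k * v $ i) * cnj (k * v $ i))"
    by (simp add: sum_distrib_left mult_ac)
  also have "\<dots> = (\<Sum>i<N. (\<Sum>j<N. g $$ (i, j) * v $ j) * cnj (\<Sum>j<N. g $$ (i, j) * v $ j))"
    using row by simp
  also have "\<dots> = (\<Sum>i<N. \<Sum>j<N. \<Sum>l<N. (v $ j * cnj (v $ l)) * (g $$ (i, j) * cnj (g $$ (i, l))))"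
    unfolding cnj_sum sum_product by (simp add: mult_ac)
  also have "\<dots> = (\<Sum>j<N. \<Sum>i<N. \<Sum>l<N. (v $ j * cnj (v $ l)) * (g $$ (i, j) * cnj (g $$ (i, l))))"
    by (rule sum.swap)
  also have "\<dots> = (\<Sum>j<N. \<Sum>l<N. \<Sum>i<N. (v $ j * cnj (v $ l)) * (g $$ (i, j) * cnj (g $$ (i, l))))"
    by (intro sum.cong refl sum.swap)
  also have "\<dots> = (\<Sum>j<N. \<Sum>l<N. if j = l then v $ j * cnj (v $ l) else 0)"
    unfolding sum_distrib_left[symmetric] using orth by (intro sum.cong refl) simp
  also have "\<dots> = ?S" by simp
  finally have eq: "(k * cnj k) * ?S = ?S" .
  have S: "?S = of_real (\<Sum>i<N. (cmod (v $ i))\<^sup>2)"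
    unfolding of_real_sum complex_norm_square ..
  obtain i where i: "i < N" "v $ i \<noteq> 0"
  proof (rule ccontr)
    assume "\<not> thesis"
    then have "v = 0\<^sub>v N" using that v(1) by (intro eq_vecI) auto
    then show False using v by simp
  qed
  have "0 < (cmod (v $ i))\<^sup>2" using i by simp
  also have "\<dots> \<le> (\<Sum>i<N. (cmod (v $ i))\<^sup>2)" using i by (intro member_le_sum) auto
  finally have "?S \<noteq> 0" unfolding S of_real_eq_0_iff by simp
  then have "k * cnj k = 1" using eq by simp
  then have "(cmod k)\<^sup>2 = 1" unfolding complex_norm_square[symmetric] by (simp only: of_real_eq_1_iff)
  then show ?thesis using norm_ge_zero[of k] by (auto simp: power2_eq_1_iff)
qed

text \<open>Triangularization is enough: w is the diagonal of a Schur form, and traces of powers as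
  well as the determinant can be read off the diagonal of a triangular matrix.\<close>

lemma unitary_eigenvalues:
  assumes g: "g \<in> unitary_group N"
  obtains w :: "nat \<Rightarrow> complex" where "\<And>i. i < N \<Longrightarrow> cmod (w i) = 1"
    "\<And>k. (\<Sum>a<N. (g ^\<^sub>m k) $$ (a, a)) = (\<Sum>i<N. w i ^ k)"
    "\<And>z. det (1\<^sub>m N - z \<cdot>\<^sub>m g) = (\<Prod>i<N. 1 - z * w i)"
proof -
  have c: "g \<in> carrier_mat N N" using g by (rule unitary_group_carrier)
  obtain es where "char_poly g = (\<Prod>a\<leftarrow>es. [:- a, 1:])" using char_poly_factorized[OF c] by auto
  from schur_decomposition_exists[OF c this] obtain B P Q where
    B: "B \<in> carrier_mat N N" "upper_triangular B" and wit: "similar_mat_wit g B P Q"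
    by (auto simp: similar_mat_def)
  note w = similar_mat_witD2[OF c wit]
  have "cmod (B $$ (i, i)) = 1" if "i < N" for i
  proof (rule unitary_eigenvalue_norm[OF g])
    have "char_poly g = char_poly B"
      using wit by (intro char_poly_similar) (auto simp: similar_mat_def)
    also have "\<dots> = (\<Prod>a\<leftarrow>diag_mat B. [:- a, 1:])" by (rule char_poly_upper_triangular[OF B])
    finally have "poly (char_poly g) (B $$ (i, i)) = (\<Prod>a\<leftarrow>diag_mat B. B $$ (i, i) - a)"
      by (simp add: poly_prod_list o_def)
    moreover have "B $$ (i, i) \<in> set (diag_mat B)" using that B by (auto simp: diag_mat_def)
    ultimately show "eigenvalue g (B $$ (i, i))"
      unfolding eigenvalue_root_char_poly[OF c] by (auto simp: prod_list_zero_iff)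
  qed
  moreover have "(\<Sum>a<N. (g ^\<^sub>m k) $$ (a, a)) = (\<Sum>i<N. B $$ (i, i) ^ k)" for k
    using trace_similar_mat_wit[of "g ^\<^sub>m k" N, OF _ similar_mat_wit_pow[OF wit]] upper_triangular_pow[OF B, of k] c by simp
  moreover have "det (1\<^sub>m N - z \<cdot>\<^sub>m g) = (\<Prod>i<N. 1 - z * B $$ (i, i))" for z
  proof -
    let ?C = "1\<^sub>m N - z \<cdot>\<^sub>m B"
    have C: "?C \<in> carrier_mat N N" using B by (intro minus_carrier_mat smult_carrier_mat)
    have zB: "z \<cdot>\<^sub>m B \<in> carrier_mat N N" using B by simp
    have PzB: "P * (z \<cdot>\<^sub>m B) \<in> carrier_mat N N" using w(6) zB by simp
    have "P * ?C * Q = (P * 1\<^sub>m N - P * (z \<cdot>\<^sub>m B)) * Q"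
      by (subst mult_minus_distrib_mat[OF w(6) one_carrier_mat zB]) simp
    also have "\<dots> = P * Q - P * (z \<cdot>\<^sub>m B) * Q"
      using w(6) minus_mult_distrib_mat[OF w(6) PzB w(7)] by simp
    also have "P * (z \<cdot>\<^sub>m B) * Q = z \<cdot>\<^sub>m (P * B * Q)"
      using mult_smult_distrib[OF w(6) w(5)] mult_smult_assoc_mat[of "P * B" N N Q N z] w(5-7) by simp
    finally have "1\<^sub>m N - z \<cdot>\<^sub>m g = P * ?C * Q" using w by simp
    moreover have cz: "1\<^sub>m N - z \<cdot>\<^sub>m g \<in> carrier_mat N N" using c by (intro minus_carrier_mat smult_carrier_mat)
    ultimately have "similar_mat_wit (1\<^sub>m N - z \<cdot>\<^sub>m g) ?C P Q"
      using similar_mat_witI[OF w(1) w(2) _ cz C w(6) w(7)] by blast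
    then have "det (1\<^sub>m N - z \<cdot>\<^sub>m g) = det ?C"
      by (intro det_similar) (auto simp: similar_mat_def)
    also have "\<dots> = prod_list (diag_mat ?C)"
      using B by (intro det_upper_triangular[OF _ C]) (auto simp: upper_triangular_def)
    also have "\<dots> = (\<Prod>i<N. 1 - z * B $$ (i, i))"
      using B by (simp add: prod_list_diag_prod atLeast0LessThan)
    finally show ?thesis .
  qed
  ultimately show thesis by (rule that)
qed

lemma prod_log_deriv:
  fixes w :: "nat \<Rightarrow> complex"
  assumes "\<And>i. i < n \<Longrightarrow> exp (- A) * w i \<noteq> 1"
  shows "((\<lambda>A. \<Prod>i<n. 1 - exp (- A) * w i) has_field_derivative
    (\<Prod>i<n. 1 - exp (- A) * w i) * (\<Sum>i<n. exp (- A) * w i / (1 - exp (- A) * w i))) (at A)"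
  using assms
proof (induction n)
  case (Suc n)
  have "((\<lambda>A. 1 - exp (- A) * w n) has_field_derivative exp (- A) * w n) (at A)"
    by (auto intro!: derivative_eq_intros)
  from DERIV_mult[OF Suc.IH this] show ?case
    using Suc.prems[of n] Suc.prems
    by (auto elim!: DERIV_cong simp: field_simps)
qed simp

text \<open>K times the Fejer mean of the geometric series, that is, the sum of its first K nonempty
  partial sums. The induction step adds one more of them.\<close>

lemma weighted_geometric_sum:
  fixes q :: complex
  assumes "q \<noteq> 1"
  shows "(\<Sum>k<K. of_nat (K - k) * q ^ k) = of_nat K / (1 - q) - q * (1 - q ^ K) / (1 - q)\<^sup>2"
proof (induction K)
  case (Suc K)
  have "(\<Sum>k<Suc K. of_nat (Suc K - k) * q ^ k) = (\<Sum>k<Suc K. of_nat (K - k) * q ^ k + q ^ k)"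
    by (intro sum.cong) (auto simp: Suc_diff_le algebra_simps)
  also have "\<dots> = (\<Sum>k<K. of_nat (K - k) * q ^ k) + (\<Sum>k<Suc K. q ^ k)"
    by (simp add: sum.distrib)
  also have "(\<Sum>k<Suc K. q ^ k) = (1 - q ^ Suc K) / (1 - q)"
    by (simp only: sum_gp_strict assms if_False)
  finally have "(\<Sum>k<Suc K. of_nat (Suc K - k) * q ^ k)
      = of_nat K / (1 - q) - q * (1 - q ^ K) / (1 - q)\<^sup>2 + (1 - q ^ Suc K) / (1 - q)" using Suc by simp
  also have "\<dots> = of_nat (Suc K) / (1 - q) - q * (1 - q ^ Suc K) / (1 - q)\<^sup>2"
    using assms by (simp add: divide_simps power2_eq_square) (simp add: algebra_simps)
  finally show ?case .
qed simp

lemma lessThan_eq_insert_0: "K \<ge> 1 \<Longrightarrow> {..<K} = insert 0 {1..K - 1 :: nat}"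
  by auto

text \<open>Dropping k = 0 turns 1/(1 - q) into q/(1 - q), the share of one eigenvalue in the
  logarithmic derivative. The last term is the exact error of the Fejer mean.\<close>

lemma weighted_geometric_sum':
  fixes q :: complex
  assumes "q \<noteq> 1" "K \<ge> 1"
  shows "q / (1 - q) = (\<Sum>k\<in>{1..K - 1}. (1 - of_nat k / of_nat K) * q ^ k) + q * (1 - q ^ K) / (of_nat K * (1 - q)\<^sup>2)"
proof -
  have "(\<Sum>k<K. of_nat (K - k) * q ^ k) = of_nat K + (\<Sum>k\<in>{1..K - 1}. of_nat (K - k) * q ^ k)"
    unfolding lessThan_eq_insert_0[OF assms(2)] by (subst sum.insert) auto
  also have "(\<Sum>k\<in>{1..K - 1}. of_nat (K - k) * q ^ k) = of_nat K * (\<Sum>k\<in>{1..K - 1}. (1 - of_nat k / of_nat K) * q ^ k)"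
    unfolding sum_distrib_left using assms(2) by (intro sum.cong refl) (auto simp: of_nat_diff field_simps)
  finally have "of_nat K * (\<Sum>k\<in>{1..K - 1}. (1 - of_nat k / of_nat K) * q ^ k)
     = of_nat K / (1 - q) - of_nat K - q * (1 - q ^ K) / (1 - q)\<^sup>2"
    using weighted_geometric_sum[OF assms(1), of K] by (simp add: algebra_simps)
  then have "(\<Sum>k\<in>{1..K - 1}. (1 - of_nat k / of_nat K) * q ^ k)
     = (of_nat K / (1 - q) - of_nat K - q * (1 - q ^ K) / (1 - q)\<^sup>2) / of_nat K"
    using assms(2) by (simp add: field_simps)
  then show ?thesis using assms by (simp add: divide_simps power2_eq_square) (simp add: algebra_simps)
qed

text \<open>The Fejer kernel: frequency d occurs K - |d| times in the square. Twice the real part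
  counts frequency 0 twice, hence the subtracted K.\<close>

lemma norm_geometric_sum_square:
  fixes z :: complex
  assumes z: "cmod z = 1"
  shows "(cmod (\<Sum>k<K. z ^ k))\<^sup>2 = 2 * Re (\<Sum>k<K. of_nat (K - k) * z ^ k) - real K"
proof (induction K)
  case (Suc K)
  have zz: "z * cnj z = 1" using complex_norm_square[of z] z by simp
  have zj: "z ^ K * cnj (z ^ k) = z ^ (K - k)" if "k \<le> K" for k
  proof -
    have "z ^ K = z ^ (K - k) * z ^ k" using that by (simp add: power_add[symmetric])
    then have "z ^ K * cnj (z ^ k) = z ^ (K - k) * (z * cnj z) ^ k"
      by (simp add: power_mult_distrib)
    then show ?thesis using zz by simp
  qed
  have "z ^ K * cnj (\<Sum>k<K. z ^ k) = (\<Sum>k<K. z ^ (K - k))"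
    unfolding cnj_sum sum_distrib_left using zj by (intro sum.cong) auto
  also have "\<dots> = (\<Sum>k<K. z ^ Suc k)"
    by (rule sum.reindex_bij_witness[of _ "\<lambda>k. K - Suc k" "\<lambda>k. K - Suc k"]) (auto simp: Suc_diff_Suc)
  also have "\<dots> = (\<Sum>k<Suc K. z ^ k) - 1" by (subst sum.lessThan_Suc_shift) simp
  finally have cross: "z ^ K * cnj (\<Sum>k<K. z ^ k) = (\<Sum>k<Suc K. z ^ k) - 1" .
  have sq: "(cmod (a + b))\<^sup>2 = (cmod a)\<^sup>2 + (cmod b)\<^sup>2 + 2 * Re (b * cnj a)" for a b
    unfolding cmod_power2 by (simp add: power2_eq_square algebra_simps)
  have "(cmod (\<Sum>k<Suc K. z ^ k))\<^sup>2 = (cmod (\<Sum>k<K. z ^ k))\<^sup>2 + (cmod (z ^ K))\<^sup>2 + 2 * Re (z ^ K * cnj (\<Sum>k<K. z ^ k))"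
    using sq[of "\<Sum>k<K. z ^ k" "z ^ K"] by simp
  also have "(cmod (z ^ K))\<^sup>2 = 1" using z by (simp add: norm_power)
  finally have "(cmod (\<Sum>k<Suc K. z ^ k))\<^sup>2 = (cmod (\<Sum>k<K. z ^ k))\<^sup>2 + 2 * Re (\<Sum>k<Suc K. z ^ k) - 1"
    unfolding cross by simp
  moreover have "(\<Sum>k<Suc K. of_nat (Suc K - k) * z ^ k) = (\<Sum>k<K. of_nat (K - k) * z ^ k) + (\<Sum>k<Suc K. z ^ k)"
  proof -
    have "(\<Sum>k<Suc K. of_nat (Suc K - k) * z ^ k) = (\<Sum>k<Suc K. of_nat (K - k) * z ^ k + z ^ k)"
      by (intro sum.cong) (auto simp: Suc_diff_le algebra_simps)
    then show ?thesis by (simp add: sum.distrib)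
  qed
  ultimately show ?case using Suc by simp
qed simp

section \<open>Fejer approximation of the logarithmic derivative\<close>

text \<open>
  A Fejer kernel plus its rotation by half a period: the zeros of the two summands interlace, so
  that, unlike a single Fejer kernel, the sum has no zeros on the circle.
\<close>
definition fejer_pair :: "nat \<Rightarrow> complex \<Rightarrow> real" where
  "fejer_pair K z = ((cmod (\<Sum>k<K. z ^ k))\<^sup>2 + (cmod (\<Sum>k<K. (cis (pi / real K) * z) ^ k))\<^sup>2) / (real K)\<^sup>2"

text \<open>Multiplied by 1 - z and by 1 - \<omega> z, the geometric sums become 1 - z^K and 1 +
  z^K. By the parallelogram law their squared moduli add up to 4, so they are not small together.
  Replacing \<omega> z by z costs at most pi in K |1 - z|.\<close>

lemma fejer_pair_lower_bound:
  assumes z: "cmod z = 1" and K: "K \<ge> 1"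
  shows "4 \<le> fejer_pair K z * (real K * cmod (1 - z) + pi)\<^sup>2"
proof -
  define \<omega> where "\<omega> = cis (pi / real K)"
  define u where "u = real K * cmod (1 - z)"
  define s1 where "s1 = cmod (\<Sum>k<K. z ^ k) / real K"
  define s2 where "s2 = cmod (\<Sum>k<K. (\<omega> * z) ^ k) / real K"
  have K0: "real K > 0" using K by simp
  have \<omega>K: "\<omega> ^ K = -1" using K by (simp add: \<omega>_def Complex.DeMoivre)
  have \<omega>1: "cmod (1 - \<omega>) \<le> pi / real K"
  proof -
    have "cmod (1 - \<omega>) = 2 * \<bar>sin (pi / real K / 2)\<bar>"
      unfolding \<omega>_def cis_conv_exp using dist_exp_i_1[of "pi / real K"] by (simp add: norm_minus_commute)
    also have "\<dots> \<le> 2 * \<bar>pi / real K / 2\<bar>" by (intro mult_left_mono abs_sin_x_le_abs_x) auto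
    finally show ?thesis by simp
  qed
  have "cmod (1 - \<omega> * z) \<le> cmod (1 - z) + cmod (z - \<omega> * z)"
    using norm_triangle_ineq[of "1 - z" "z - \<omega> * z"] by simp
  also have "z - \<omega> * z = (1 - \<omega>) * z" by (simp add: algebra_simps)
  finally have "cmod (1 - \<omega> * z) \<le> cmod (1 - z) + pi / real K" using z \<omega>1 by (simp add: norm_mult)
  then have v: "real K * cmod (1 - \<omega> * z) \<le> u + pi" using K0 by (simp add: u_def field_simps)
  have "cmod (1 - z ^ K) = s1 * u"
    using arg_cong[OF one_diff_power_eq[of z K], of cmod] K0 by (simp add: s1_def u_def norm_mult)
  also have "\<dots> \<le> s1 * (u + pi)" by (intro mult_left_mono) (auto simp: s1_def)
  finally have "cmod (1 - z ^ K) \<le> s1 * (u + pi)" .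
  then have a: "(cmod (1 - z ^ K))\<^sup>2 \<le> s1\<^sup>2 * (u + pi)\<^sup>2"
    unfolding power_mult_distrib[symmetric] by (intro power_mono) auto
  have "cmod (1 + z ^ K) = s2 * (real K * cmod (1 - \<omega> * z))"
    using arg_cong[OF one_diff_power_eq[of "\<omega> * z" K], of cmod] K0
    by (simp add: s2_def norm_mult power_mult_distrib \<omega>K)
  also have "\<dots> \<le> s2 * (u + pi)" using v by (intro mult_left_mono) (auto simp: s2_def)
  finally have "cmod (1 + z ^ K) \<le> s2 * (u + pi)" .
  then have b: "(cmod (1 + z ^ K))\<^sup>2 \<le> s2\<^sup>2 * (u + pi)\<^sup>2"
    unfolding power_mult_distrib[symmetric] by (intro power_mono) auto
  have "(cmod (1 - w))\<^sup>2 + (cmod (1 + w))\<^sup>2 = 2 + 2 * (cmod w)\<^sup>2" for w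
    unfolding cmod_power2 by (simp add: power2_eq_square algebra_simps)
  from this[of "z ^ K"] have "4 = (cmod (1 - z ^ K))\<^sup>2 + (cmod (1 + z ^ K))\<^sup>2"
    using z by (simp add: norm_power)
  also have "\<dots> \<le> s1\<^sup>2 * (u + pi)\<^sup>2 + s2\<^sup>2 * (u + pi)\<^sup>2" using a b by simp
  also have "\<dots> = fejer_pair K z * (u + pi)\<^sup>2"
    by (simp add: fejer_pair_def s1_def s2_def \<omega>_def power_divide algebra_simps add_divide_distrib)
  finally show ?thesis by (simp add: u_def)
qed

lemma fejer_pair_nonneg: "fejer_pair K z \<ge> 0"
  by (simp add: fejer_pair_def)

text \<open>Summed over N eigenvalues, the constant coefficient becomes the deterministic 2 N / K
  and the rest a combination of power sums of positive index.\<close>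

lemma fejer_pair_fourier:
  assumes z: "cmod z = 1" and K: "K \<ge> 1"
  shows "fejer_pair K z = 2 / real K +
     2 * Re (\<Sum>k\<in>{1..K - 1}. of_nat (K - k) / of_nat (K * K) * (1 + cis (pi / real K) ^ k) * z ^ k)"
proof -
  let ?\<omega> = "cis (pi / real K)"
  have split: "(\<Sum>k<K. of_nat (K - k) * q ^ k) = of_nat K + (\<Sum>k\<in>{1..K - 1}. of_nat (K - k) * q ^ k)" for q :: complex
    unfolding lessThan_eq_insert_0[OF K] by (subst sum.insert) auto
  have sq: "(cmod (\<Sum>k<K. q ^ k))\<^sup>2 = real K + 2 * Re (\<Sum>k\<in>{1..K - 1}. of_nat (K - k) * q ^ k)" if "cmod q = 1" for q
    unfolding norm_geometric_sum_square[OF that] split by simp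
  have "(\<Sum>k\<in>{1..K - 1}. of_nat (K - k) / of_nat (K * K) * (1 + ?\<omega> ^ k) * z ^ k)
    = ((\<Sum>k\<in>{1..K - 1}. of_nat (K - k) * z ^ k) + (\<Sum>k\<in>{1..K - 1}. of_nat (K - k) * (?\<omega> * z) ^ k)) / complex_of_real ((real K)\<^sup>2)"
    unfolding sum.distrib[symmetric] sum_divide_distrib using K
    by (intro sum.cong refl) (auto simp: power2_eq_square power_mult_distrib field_simps)
  then have h: "Re (\<Sum>k\<in>{1..K - 1}. of_nat (K - k) / of_nat (K * K) * (1 + ?\<omega> ^ k) * z ^ k)
    = (Re (\<Sum>k\<in>{1..K - 1}. of_nat (K - k) * z ^ k) + Re (\<Sum>k\<in>{1..K - 1}. of_nat (K - k) * (?\<omega> * z) ^ k)) / (real K)\<^sup>2"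
    by (simp only: Re_divide_of_real plus_complex.sel)
  have \<omega>z: "cmod (?\<omega> * z) = 1" using z by (simp add: norm_mult)
  have "((k + 2 * x) + (k + 2 * y)) / k\<^sup>2 = 2 / k + 2 * ((x + y) / k\<^sup>2)" if "k > 0" for x y k :: real
    using that by (simp add: field_simps power2_eq_square)
  from this[of "real K"] show ?thesis
    unfolding fejer_pair_def sq[OF z] sq[OF \<omega>z] h using K by simp
qed

text \<open>With u = K |1 - z| the error is at most c N and also at most 8 K / u^2. The lower bound
  for \<open>fejer_pair\<close> has the same two regimes, so one constant serves both; at u = pi the
  larger summand of u + pi changes.\<close>

lemma fejer_remainder_bound:
  fixes r c :: real
  assumes z: "cmod z = 1" and r: "0 < r" "r < 1" and K: "1 \<le> K" "K \<le> N"
    and c: "c \<ge> 1" "1 / (1 - r) \<le> c * real N"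
  defines "q \<equiv> complex_of_real r * z"
  shows "cmod (q * (1 - q ^ K) / (of_nat K * (1 - q)\<^sup>2)) \<le> real N * (pi\<^sup>2 * c) * fejer_pair K z"
proof -
  define d where "d = cmod (1 - q)"
  define u where "u = real K * cmod (1 - z)"
  define E where "E = cmod (q * (1 - q ^ K) / (of_nat K * (1 - q)\<^sup>2))"
  have K0: "real K > 0" using K by simp
  have nq: "cmod q = r" using z r by (simp add: q_def norm_mult)
  have d: "d \<ge> 1 - r" unfolding d_def using norm_triangle_ineq2[of 1 q] nq by simp
  then have d0: "d > 0" using r by simp
  have E: "E = r * cmod (1 - q ^ K) / (real K * d\<^sup>2)"
    by (simp add: E_def norm_mult norm_divide norm_power nq d_def)
  \<comment> \<open>Moving from z radially to q costs 1 - r, which is itself at most d, so 1 is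
    never much closer to q than to z.\<close>
  have "cmod (1 - z) \<le> cmod (1 - q) + cmod (q - z)" using norm_triangle_ineq[of "1 - q" "q - z"] by simp
  also have "q - z = complex_of_real (r - 1) * z" by (simp add: q_def algebra_simps)
  also have "cmod \<dots> = 1 - r" using r z by (simp only: norm_mult norm_of_real) simp
  finally have zd: "cmod (1 - z) \<le> 2 * d" using d by (simp add: d_def)
  \<comment> \<open>One factor 1 - q cancels against 1 - q^K; the other leaves 1/d.\<close>
  have E1: "E \<le> c * real N"
  proof -
    have "cmod (1 - q ^ K) = d * cmod (\<Sum>i<K. q ^ i)"
      unfolding d_def one_diff_power_eq norm_mult ..
    also have "\<dots> \<le> d * real K"
    proof (intro mult_left_mono)
      have "cmod (\<Sum>i<K. q ^ i) \<le> (\<Sum>i<K. cmod (q ^ i))" by (rule norm_sum)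
      also have "\<dots> \<le> (\<Sum>i<K. 1)" using nq r by (intro sum_mono) (auto simp: norm_power power_le_one)
      finally show "cmod (\<Sum>i<K. q ^ i) \<le> real K" by simp
    qed (use d0 in auto)
    finally have "r * cmod (1 - q ^ K) \<le> 1 * (d * real K)" using r by (intro mult_mono) auto
    then have "E \<le> d * real K / (real K * d\<^sup>2)"
      unfolding E using K0 d0 by (intro divide_right_mono) auto
    also have "\<dots> = 1 / d" using K0 d0 by (simp add: power2_eq_square)
    also have "\<dots> \<le> 1 / (1 - r)" using d r by (intro divide_left_mono) auto
    finally show ?thesis using c(2) by simp
  qed
  have J: "4 \<le> fejer_pair K z * (u + pi)\<^sup>2" unfolding u_def by (rule fejer_pair_lower_bound[OF z K(1)])
  have J0: "fejer_pair K z \<ge> 0" by (rule fejer_pair_nonneg)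
  have pi3: "pi > 3" using pi_gt3 .
  have "E \<le> real N * (pi\<^sup>2 * c) * fejer_pair K z"
  proof (cases "u \<le> pi")
    case True
    have "(u + pi)\<^sup>2 \<le> (2 * pi)\<^sup>2" using True by (intro power_mono) (auto simp: u_def)
    then have "4 \<le> fejer_pair K z * (2 * pi)\<^sup>2" using J J0 mult_left_mono[of "(u + pi)\<^sup>2" "(2 * pi)\<^sup>2" "fejer_pair K z"] by linarith
    then have "1 \<le> fejer_pair K z * pi\<^sup>2" by (simp add: power_mult_distrib)
    then have "c * real N * 1 \<le> c * real N * (fejer_pair K z * pi\<^sup>2)" using c by (intro mult_left_mono) auto
    then show ?thesis using E1 by (simp add: mult_ac)
  next
    case False
    then have u: "u > pi" by simp
    then have u0: "u > 0" using pi3 by simp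
    have "(u + pi)\<^sup>2 \<le> (2 * u)\<^sup>2" using u pi3 by (intro power_mono) auto
    then have "4 \<le> fejer_pair K z * (2 * u)\<^sup>2" using J J0 mult_left_mono[of "(u + pi)\<^sup>2" "(2 * u)\<^sup>2" "fejer_pair K z"] by linarith
    then have Ju: "1 \<le> fejer_pair K z * u\<^sup>2" by (simp add: power_mult_distrib)
    have "cmod (1 - q ^ K) \<le> 2"
      using norm_triangle_ineq4[of 1 "q ^ K"] nq r power_le_one[of r K] by (simp add: norm_power)
    then have "r * cmod (1 - q ^ K) \<le> 1 * 2" using r by (intro mult_mono) auto
    then have "E \<le> 2 / (real K * d\<^sup>2)"
      unfolding E using K0 d0 by (intro divide_right_mono) auto
    also have "\<dots> = 8 * real K / (real K * (2 * d))\<^sup>2" using K0 d0 by (simp add: power2_eq_square field_simps)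
    also have "\<dots> \<le> 8 * real K / u\<^sup>2"
      using zd u0 K0 d0 unfolding u_def by (intro divide_left_mono power_mono mult_left_mono mult_pos_pos zero_less_power) auto
    also have "\<dots> \<le> 8 * real K * fejer_pair K z"
      using Ju u0 K0 by (simp add: field_simps)
    \<comment> \<open>The constant 8 is absorbed by pi^2 \<ge> 9, and K by N.\<close>
    also have "\<dots> \<le> (pi\<^sup>2 * c) * real N * fejer_pair K z"
    proof -
      have "9 \<le> pi\<^sup>2" using power_mono[of 3 pi 2] pi3 by simp
      then have "8 * 1 \<le> pi\<^sup>2 * c" using c by (intro mult_mono) auto
      then show ?thesis using K J0 by (intro mult_right_mono mult_mono) auto
    qed
    finally show ?thesis by (simp add: mult_ac)
  qed
  then show ?thesis unfolding E_def .
qed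

text \<open>The coefficient of \<open>ptr k\<close> in 1/N times the Fejer mean of order K of the
  logarithmic derivative at a point with exp (- A) = r.\<close>

definition fejer_coeff :: "nat \<Rightarrow> nat \<Rightarrow> real \<Rightarrow> nat \<Rightarrow> complex" where
  "fejer_coeff N K r k = (1 - of_nat k / of_nat K) * of_real r ^ k / of_nat N"

definition fejer_pair_coeff :: "nat \<Rightarrow> nat \<Rightarrow> complex" where
  "fejer_pair_coeff K k = of_nat (K - k) / of_nat (K * K) * (1 + cis (pi / real K) ^ k)"

text \<open>The natural bound 1/N is relaxed to 1/K so that both families of coefficients fit
  \<open>sum_weighted_squares_le\<close>.\<close>

lemma norm_fejer_coeff_le:
  assumes "0 < r" "r < 1" "1 \<le> K" "K \<le> N" "k \<in> {1..K - 1}"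
  shows "cmod (fejer_coeff N K r k) \<le> 1 / real K"
proof -
  have "complex_of_real (1 - real k / real K) = 1 - of_nat k / of_nat K" by simp
  then have "cmod (fejer_coeff N K r k) = \<bar>1 - real k / real K\<bar> * r ^ k / real N"
    unfolding fejer_coeff_def using assms
    by (metis (no_types, lifting) abs_of_pos norm_divide norm_mult norm_of_nat norm_of_real norm_power)
  also have "\<bar>1 - real k / real K\<bar> \<le> 1" using assms by (auto simp: abs_le_iff field_simps)
  then have "\<bar>1 - real k / real K\<bar> * r ^ k / real N \<le> 1 * 1 / real K"
    using assms by (intro frac_le mult_mono) (auto intro: power_le_one)
  finally show ?thesis by simp
qed

lemma norm_fejer_pair_coeff_le:
  assumes "1 \<le> K" "k \<in> {1..K - 1}"
  shows "cmod (fejer_pair_coeff K k) \<le> 2 / real K"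
proof -
  have "cmod (1 + cis (pi / real K) ^ k) \<le> 2"
    using norm_triangle_ineq[of 1 "cis (pi / real K) ^ k"] by (simp add: norm_power)
  moreover have "real (K - k) / real (K * K) \<le> real K / real (K * K)"
    by (intro divide_right_mono) auto
  ultimately have "real (K - k) / real (K * K) * cmod (1 + cis (pi / real K) ^ k) \<le> real K / real (K * K) * 2"
    by (intro mult_mono) auto
  then show ?thesis
    unfolding fejer_pair_coeff_def norm_mult norm_divide norm_of_nat using assms by simp
qed

context haar_unitary
begin

text \<open>A deterministic inequality for each unitary g: \<open>weighted_geometric_sum'\<close> is
  applied at every eigenvalue, and the kernel that dominates the remainders is expanded back into
  power sums. C is the constant of \<open>fejer_remainder_bound\<close> for c = 1 +
  1/\<alpha>.\<close>

lemma log_deriv_bound: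
  assumes \<alpha>: "\<alpha> > 0" and K: "1 \<le> K" "K \<le> N" and g: "g \<in> unitary_group N"
  defines "C \<equiv> pi\<^sup>2 * (1 + 1 / \<alpha>)" and "r \<equiv> exp (- (\<alpha> / real N))"
  shows "1 / real N * cmod (deriv (Lambda g) (complex_of_real (\<alpha> / real N)) / Lambda g (complex_of_real (\<alpha> / real N)))
    \<le> 2 * C * real N / real K + cmod (ptr_comb (fejer_coeff N K r) (K - 1) g)
       + 2 * C * cmod (ptr_comb (fejer_pair_coeff K) (K - 1) g)"
proof -
  have N0: "real N > 0" using K by simp
  have r: "0 < r" "r < 1" using \<alpha> N0 by (auto simp: r_def)
  \<comment> \<open>From exp t \<ge> 1 + t at t = \<alpha>/N; then N \<ge> 1 turns 1 + N/\<alpha>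
    into a multiple of N.\<close>
  have c: "1 / (1 - r) \<le> (1 + 1 / \<alpha>) * real N"
  proof -
    define t where "t = \<alpha> / real N"
    have t: "t > 0" using \<alpha> N0 by (simp add: t_def)
    have "1 + t \<le> exp t" by (rule exp_ge_add_one_self)
    then have "r \<le> 1 / (1 + t)" unfolding r_def t_def[symmetric] exp_minus using t
      by (simp add: divide_simps)
    then have "t / (1 + t) \<le> 1 - r" using t by (simp add: field_simps)
    then have "1 / (1 - r) \<le> 1 / (t / (1 + t))" using t r by (intro divide_left_mono) auto
    also have "\<dots> = 1 + real N / \<alpha>" using t N0 \<alpha> by (simp add: t_def field_simps)
    also have "\<dots> \<le> (1 + 1 / \<alpha>) * real N" using K by (simp add: algebra_simps)
    finally show ?thesis .
  qed
  have c1: "1 + 1 / \<alpha> \<ge> 1" using \<alpha> by simp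
  have C0: "C \<ge> 0" using \<alpha> by (simp add: C_def)
  obtain w :: "nat \<Rightarrow> complex" where w: "\<And>i. i < N \<Longrightarrow> cmod (w i) = 1"
    "\<And>k. (\<Sum>a<N. (g ^\<^sub>m k) $$ (a, a)) = (\<Sum>i<N. w i ^ k)"
    "\<And>z. det (1\<^sub>m N - z \<cdot>\<^sub>m g) = (\<Prod>i<N. 1 - z * w i)"
    using unitary_eigenvalues[OF g] by blast
  have p: "ptr k g = (\<Sum>i<N. w i ^ k)" for k using w(2) by (simp add: ptr_def)
  define q where "q i = complex_of_real r * w i" for i
  have ex: "exp (- complex_of_real (\<alpha> / real N)) = complex_of_real r"
    unfolding r_def of_real_minus[symmetric] by (rule exp_of_real)
  have q1: "q i \<noteq> 1" if "i < N" for i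
  proof
    assume "q i = 1"
    then have "cmod (q i) = 1" by simp
    then show False using r w(1)[OF that] by (simp add: q_def norm_mult)
  qed
  have Lam: "Lambda g = (\<lambda>A. \<Prod>i<N. 1 - exp (- A) * w i)"
    using unitary_group_carrier[OF g] by (auto simp: Lambda_def w(3))
  have L0: "Lambda g (complex_of_real (\<alpha> / real N)) \<noteq> 0"
    unfolding Lam ex using q1 by (auto simp: q_def)
  have "deriv (Lambda g) (complex_of_real (\<alpha> / real N)) =
      Lambda g (complex_of_real (\<alpha> / real N)) * (\<Sum>i<N. q i / (1 - q i))"
    using prod_log_deriv[of N "complex_of_real (\<alpha> / real N)" w] q1
    unfolding Lam ex q_def by (intro DERIV_imp_deriv) auto
  then have quot: "deriv (Lambda g) (complex_of_real (\<alpha> / real N)) / Lambda g (complex_of_real (\<alpha> / real N)) = (\<Sum>i<N. q i / (1 - q i))"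
    using L0 by simp
  define e where "e i = q i * (1 - q i ^ K) / (of_nat K * (1 - q i)\<^sup>2)" for i
  have "(\<Sum>i<N. q i / (1 - q i)) = (\<Sum>i<N. (\<Sum>k\<in>{1..K - 1}. (1 - of_nat k / of_nat K) * q i ^ k) + e i)"
    using weighted_geometric_sum'[OF q1 K(1)] unfolding e_def by (intro sum.cong) auto
  also have "\<dots> = (\<Sum>k\<in>{1..K - 1}. \<Sum>i<N. (1 - of_nat k / of_nat K) * q i ^ k) + (\<Sum>i<N. e i)"
    unfolding sum.distrib by (subst sum.swap) simp
  also have "(\<Sum>k\<in>{1..K - 1}. \<Sum>i<N. (1 - of_nat k / of_nat K) * q i ^ k) = of_nat N * ptr_comb (fejer_coeff N K r) (K - 1) g"
    unfolding ptr_comb_def p fejer_coeff_def sum_distrib_left q_def using N0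
    by (intro sum.cong refl) (auto simp: power_mult_distrib)
  finally have "cmod (\<Sum>i<N. q i / (1 - q i)) \<le> real N * cmod (ptr_comb (fejer_coeff N K r) (K - 1) g) + cmod (\<Sum>i<N. e i)"
    using norm_triangle_ineq[of "of_nat N * ptr_comb (fejer_coeff N K r) (K - 1) g" "\<Sum>i<N. e i"] by (simp add: norm_mult)
  moreover have "cmod (\<Sum>i<N. e i) \<le> real N * C * (2 * real N / real K + 2 * cmod (ptr_comb (fejer_pair_coeff K) (K - 1) g))"
  proof -
    have "cmod (\<Sum>i<N. e i) \<le> (\<Sum>i<N. cmod (e i))" by (rule norm_sum)
    also have "\<dots> \<le> (\<Sum>i<N. real N * C * fejer_pair K (w i))"
      unfolding e_def q_def C_def using w(1) by (intro sum_mono fejer_remainder_bound r K c c1) auto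
    also have "\<dots> = real N * C * (\<Sum>i<N. fejer_pair K (w i))" by (rule sum_distrib_left[symmetric])
    also have "(\<Sum>i<N. fejer_pair K (w i)) = (\<Sum>i<N. 2 / real K + 2 * Re (\<Sum>k\<in>{1..K - 1}. fejer_pair_coeff K k * w i ^ k))"
      using w(1) K unfolding fejer_pair_coeff_def by (intro sum.cong refl fejer_pair_fourier) auto
    also have "\<dots> = 2 * real N / real K + 2 * Re (\<Sum>i<N. \<Sum>k\<in>{1..K - 1}. fejer_pair_coeff K k * w i ^ k)"
      by (simp add: sum.distrib sum_distrib_left)
    also have "(\<Sum>i<N. \<Sum>k\<in>{1..K - 1}. fejer_pair_coeff K k * w i ^ k) = ptr_comb (fejer_pair_coeff K) (K - 1) g"
      unfolding ptr_comb_def p sum_distrib_left by (rule sum.swap)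
    also have "real N * C * (2 * real N / real K + 2 * Re (ptr_comb (fejer_pair_coeff K) (K - 1) g))
        \<le> real N * C * (2 * real N / real K + 2 * cmod (ptr_comb (fejer_pair_coeff K) (K - 1) g))"
      using C0 N0 complex_Re_le_cmod by (intro mult_left_mono add_left_mono) auto
    finally show ?thesis .
  qed
  ultimately have "cmod (\<Sum>i<N. q i / (1 - q i)) \<le> real N * (cmod (ptr_comb (fejer_coeff N K r) (K - 1) g)
     + C * (2 * real N / real K + 2 * cmod (ptr_comb (fejer_pair_coeff K) (K - 1) g)))"
    by (simp add: algebra_simps)
  then have "1 / real N * cmod (\<Sum>i<N. q i / (1 - q i)) \<le> cmod (ptr_comb (fejer_coeff N K r) (K - 1) g)
     + C * (2 * real N / real K + 2 * cmod (ptr_comb (fejer_pair_coeff K) (K - 1) g))"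
    using N0 by (simp add: field_simps)
  then show ?thesis unfolding quot by (simp add: algebra_simps)
qed

end

section \<open>The tail bound\<close>

text \<open>Fewer than K terms, each at most K (b/K)^2: the variance of the combination is bounded
  independently of K and N.\<close>

lemma sum_weighted_squares_le:
  assumes K: "K \<ge> 1" and a: "\<And>k. k \<in> {1..K - 1} \<Longrightarrow> cmod (a k) \<le> b / real K"
  shows "(\<Sum>k\<in>{1..K - 1}. real k * (cmod (a k))\<^sup>2) \<le> b\<^sup>2"
proof -
  have "(\<Sum>k\<in>{1..K - 1}. real k * (cmod (a k))\<^sup>2) \<le> (\<Sum>k\<in>{1..K - 1}. real K * (b / real K)\<^sup>2)"
    using a by (intro sum_mono mult_mono power_mono) auto
  also have "\<dots> = real (K - 1) / real K * b\<^sup>2" using K by (simp add: power2_eq_square field_simps)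
  also have "\<dots> \<le> 1 * b\<^sup>2" using K by (intro mult_right_mono) auto
  finally show ?thesis by simp
qed

text \<open>The threshold splits as 6 C y = 2 C y + 4 C y. The deterministic part takes the first
  share; exceeding the second forces |X1| \<ge> 2 y or |X2| \<ge> y, since C \<ge> 1.\<close>

lemma (in haar_unitary) log_deriv_tail:
  fixes \<alpha> y :: real
  assumes \<alpha>: "\<alpha> > 0" and N: "N \<ge> 1" and y: "y \<ge> 4"
  defines "C \<equiv> pi\<^sup>2 * (1 + 1 / \<alpha>)"
  shows "measure \<mu> {g \<in> space \<mu>. 6 * C * y \<le>
      1 / real N * cmod (deriv (Lambda g) (complex_of_real (\<alpha> / real N)) / Lambda g (complex_of_real (\<alpha> / real N)))}
    \<le> 2 * exp (- (y / 2 * ln (y / 4)))"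
proof -
  \<comment> \<open>The least K with N/K \<le> y. The degree K - 1, unlike K itself, is still at
    most N/y, so moments of order m up to y are available.\<close>
  define K where "K = nat \<lceil>real N / y\<rceil>"
  define m where "m = nat \<lfloor>y\<rfloor>"
  define r where "r = exp (- (\<alpha> / real N))"
  define X1 where "X1 = ptr_comb (fejer_coeff N K r) (K - 1)"
  define X2 where "X2 = ptr_comb (fejer_pair_coeff K) (K - 1)"
  have "9 \<le> pi\<^sup>2" using power_mono[of 3 pi 2] pi_gt3 by simp
  then have "1 * 1 \<le> pi\<^sup>2 * (1 + 1 / \<alpha>)" using \<alpha> by (intro mult_mono) auto
  then have C: "C \<ge> 1" by (simp add: C_def)
  have N0: "real N > 0" using N by simp
  have Ny: "real N / y > 0" using N0 y by simp
  then have K_ceil: "real K = of_int \<lceil>real N / y\<rceil>" by (simp add: K_def)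
  have "\<lceil>real N / y\<rceil> > 0" using Ny by simp
  then have K1: "K \<ge> 1" unfolding K_def by linarith
  have KN: "K \<le> N"
  proof -
    have "real N / y \<le> real N" using y N0 by (simp add: divide_le_eq)
    then show ?thesis unfolding K_def by (simp add: ceiling_le_iff)
  qed
  have K_ge: "real N / real K \<le> y"
  proof -
    have "real N / y \<le> real K" unfolding K_ceil by simp
    then show ?thesis using y K1 by (simp add: field_simps)
  qed
  have m: "real m \<le> y" "y / 2 \<le> real m"
    using y unfolding m_def by linarith+
  have mK: "m * (K - 1) \<le> N"
  proof -
    have "real (K - 1) \<le> real N / y" using K1 K_ceil by linarith
    then have "real m * real (K - 1) \<le> y * (real N / y)" using m y by (intro mult_mono) auto
    also have "\<dots> = real N" using y by simp
    finally show ?thesis by (metis of_nat_le_iff of_nat_mult)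
  qed
  have r: "0 < r" "r < 1" using \<alpha> N0 by (auto simp: r_def)
  have V1: "(\<Sum>k\<in>{1..K - 1}. real k * (cmod (fejer_coeff N K r k))\<^sup>2) \<le> 1\<^sup>2"
    by (intro sum_weighted_squares_le K1 norm_fejer_coeff_le r KN)
  have V2: "(\<Sum>k\<in>{1..K - 1}. real k * (cmod (fejer_pair_coeff K k))\<^sup>2) \<le> 2\<^sup>2"
    by (intro sum_weighted_squares_le K1 norm_fejer_pair_coeff_le)
  let ?A = "{g \<in> unitary_group N. cmod (X1 g) \<ge> 2 * y}"
  let ?B = "{g \<in> unitary_group N. cmod (X2 g) \<ge> y}"
  have A: "?A \<in> sets \<mu>" "measure \<mu> ?A \<le> fact m * (1\<^sup>2 / (2 * y)\<^sup>2) ^ m"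
    unfolding X1_def using ptr_comb_tail[OF mK _ V1, of "2 * y"] y by simp_all
  have B: "?B \<in> sets \<mu>" "measure \<mu> ?B \<le> fact m * (2\<^sup>2 / y\<^sup>2) ^ m"
    unfolding X2_def using ptr_comb_tail[OF mK _ V2, of y] y by simp_all
  have "{g \<in> space \<mu>. 6 * C * y \<le>
      1 / real N * cmod (deriv (Lambda g) (complex_of_real (\<alpha> / real N)) / Lambda g (complex_of_real (\<alpha> / real N)))}
    \<subseteq> ?A \<union> ?B"
  proof
    fix g assume "g \<in> {g \<in> space \<mu>. 6 * C * y \<le>
      1 / real N * cmod (deriv (Lambda g) (complex_of_real (\<alpha> / real N)) / Lambda g (complex_of_real (\<alpha> / real N)))}"
    then have g: "g \<in> unitary_group N"
      and big: "6 * C * y \<le> 1 / real N * cmod (deriv (Lambda g) (complex_of_real (\<alpha> / real N)) / Lambda g (complex_of_real (\<alpha> / real N)))"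
      by auto
    note big
    also note log_deriv_bound[OF \<alpha> K1 KN g, folded C_def r_def, folded X1_def X2_def]
    also have "2 * C * real N / real K = 2 * C * (real N / real K)" by simp
    also have "2 * C * (real N / real K) \<le> 2 * C * y" using K_ge C by (intro mult_left_mono) auto
    finally have le: "4 * C * y \<le> cmod (X1 g) + 2 * C * cmod (X2 g)" by (simp add: algebra_simps)
    show "g \<in> ?A \<union> ?B"
    proof (rule ccontr)
      assume "g \<notin> ?A \<union> ?B"
      then have "cmod (X1 g) < 2 * y" "cmod (X2 g) < y" using g by auto
      moreover have "2 * y \<le> 2 * C * y" using C y by simp
      moreover have "2 * C * cmod (X2 g) < 2 * C * y" using \<open>cmod (X2 g) < y\<close> C by simp
      ultimately show False using le by (simp add: algebra_simps)
    qed
  qed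
  then have "measure \<mu> {g \<in> space \<mu>. 6 * C * y \<le>
      1 / real N * cmod (deriv (Lambda g) (complex_of_real (\<alpha> / real N)) / Lambda g (complex_of_real (\<alpha> / real N)))}
    \<le> measure \<mu> (?A \<union> ?B)" using A B by (intro finite_measure_mono) auto
  also have "\<dots> \<le> measure \<mu> ?A + measure \<mu> ?B" using A B by (intro measure_Un_le) auto
  also have "\<dots> \<le> fact m * (1\<^sup>2 / (2 * y)\<^sup>2) ^ m + fact m * (2\<^sup>2 / y\<^sup>2) ^ m" using A B by (intro add_mono)
  also have "(1\<^sup>2 / (2 * y)\<^sup>2) ^ m \<le> (4 / y\<^sup>2) ^ m"
    using y by (intro power_mono) (auto simp: divide_simps power2_eq_square)
  then have "fact m * (1\<^sup>2 / (2 * y)\<^sup>2) ^ m + fact m * (2\<^sup>2 / y\<^sup>2) ^ m \<le> 2 * (fact m * (4 / y\<^sup>2) ^ m)" by simp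
  \<comment> \<open>As m! \<le> m^m \<le> y^m, the factorial uses up one of the two powers of y
    gained from Markov's inequality.\<close>
  also have "\<dots> \<le> 2 * (y ^ m * (4 / y\<^sup>2) ^ m)"
  proof -
    have "fact m \<le> (of_nat (m ^ m) :: real)" by (rule fact_le_power[THEN order_trans]) auto
    also have "\<dots> \<le> y ^ m" using m by (simp add: power_mono)
    finally show ?thesis using y by (intro mult_left_mono mult_right_mono) auto
  qed
  also have "y ^ m * (4 / y\<^sup>2) ^ m = (4 / y) ^ m"
    unfolding power_mult_distrib[symmetric] using y by (simp add: power2_eq_square)
  also have "(4 / y) ^ m = exp (- (real m * ln (y / 4)))"
  proof -
    have "4 / y = exp (- ln (y / 4))" using y by (simp add: exp_minus exp_ln)
    then show ?thesis by (simp add: exp_of_nat_mult[symmetric])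
  qed
  also have "\<dots> \<le> exp (- (y / 2 * ln (y / 4)))"
  proof -
    have "y / 2 * ln (y / 4) \<le> real m * ln (y / 4)" using m y by (intro mult_right_mono) auto
    then show ?thesis by simp
  qed
  finally show ?thesis by simp
qed

theorem theorem4p10:
  fixes \<alpha> :: real
  assumes "\<alpha> > 0"
  shows "\<exists>C K :: real. C > 0 \<and> K > 0 \<and>
    (\<forall>(x :: real) (N :: nat) (\<mu> :: complex mat measure).
      x \<ge> 2 \<longrightarrow> N \<ge> 1 \<longrightarrow> haar_prob_unitary N \<mu> \<longrightarrow>
      measure \<mu> {g \<in> space \<mu>.
        1 / real N * cmod (deriv (Lambda g) (complex_of_real (\<alpha> / real N))
                             / Lambda g (complex_of_real (\<alpha> / real N))) \<ge> x}
      \<le> K * exp (- C * x * ln x))"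
proof -
  define D where "D = pi\<^sup>2 * (1 + 1 / \<alpha>)"
  have "9 \<le> pi\<^sup>2" using power_mono[of 3 pi 2] pi_gt3 by simp
  then have "1 * 1 \<le> pi\<^sup>2 * (1 + 1 / \<alpha>)" using assms by (intro mult_mono) auto
  then have D: "D \<ge> 1" by (simp add: D_def)
  \<comment> \<open>With y = x / (6 D) this gives y/4 = C x. Beyond \<open>x0\<close> one has sqrt x
    \<ge> 24 D, hence y/4 \<ge> sqrt x and ln (y/4) \<ge> ln x / 2. Below \<open>x0\<close> the
    trivial bound 1 is absorbed by the exponential in K.\<close>
  define C where "C = 1 / (24 * D)"
  define x0 where "x0 = (24 * D)\<^sup>2"
  define K where "K = 2 + exp (C * x0 * ln x0)"
  have C0: "C > 0" using D by (simp add: C_def)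
  have K: "K > 0" "K \<ge> 2" by (auto simp: K_def add_pos_pos)
  have "measure \<mu> {g \<in> space \<mu>. 1 / real N * cmod (deriv (Lambda g) (complex_of_real (\<alpha> / real N))
                             / Lambda g (complex_of_real (\<alpha> / real N))) \<ge> x} \<le> K * exp (- C * x * ln x)"
    (is "measure \<mu> ?S \<le> _") if x: "x \<ge> 2" and N: "N \<ge> 1" and haar: "haar_prob_unitary N \<mu>" for x N \<mu>
  proof -
    interpret haar_unitary N \<mu> by unfold_locales (rule haar)
    show ?thesis
    proof (cases "x \<ge> x0")
      case True
      define y where "y = x / (6 * D)"
      have xy: "6 * D * y = x" using D by (simp add: y_def)
      have "x0 \<ge> 24 * D" unfolding x0_def power2_eq_square using D by simp
      then have y4: "y \<ge> 4" using True D by (simp add: y_def field_simps)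
      have "ln x \<le> 2 * ln (y / 4)"
      proof -
        have "24 * D = sqrt x0" using D unfolding x0_def by (simp only: real_sqrt_abs)
        also have "\<dots> \<le> sqrt x" using True by simp
        finally have "24 * D * sqrt x \<le> sqrt x * sqrt x" using x by (intro mult_right_mono) auto
        then have "sqrt x \<le> y / 4" using D x by (simp add: y_def field_simps)
        then have "ln (sqrt x) \<le> ln (y / 4)" using x y4 by (subst ln_le_cancel_iff) auto
        then show ?thesis using x by (simp add: ln_sqrt)
      qed
      then have "y / 4 * ln x \<le> y / 4 * (2 * ln (y / 4))" using y4 by (intro mult_left_mono) auto
      moreover have "y / 4 = C * x" using D by (simp add: y_def C_def)
      ultimately have le: "C * x * ln x \<le> y / 2 * ln (y / 4)" by simp
      have "measure \<mu> ?S \<le> 2 * exp (- (y / 2 * ln (y / 4)))"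
        using log_deriv_tail[OF assms N y4] unfolding D_def[symmetric] xy .
      also have "\<dots> \<le> K * exp (- C * x * ln x)"
        using K le by (intro mult_mono) auto
      finally show ?thesis .
    next
      case False
      have "measure \<mu> ?S \<le> 1" by simp
      also have "1 = exp (C * x * ln x) * exp (- C * x * ln x)" by (simp add: exp_add[symmetric])
      also have "\<dots> \<le> K * exp (- C * x * ln x)"
      proof (intro mult_right_mono)
        have "C * x * ln x \<le> C * x0 * ln x0"
          using False x C0 by (intro mult_mono) auto
        then show "exp (C * x * ln x) \<le> K" unfolding K_def by (simp add: add_increasing)
      qed simp
      finally show ?thesis .
    qed
  qed
  then show ?thesis using C0 K by blast
qed

end
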